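(* $\mathcal{E}$ and $\mathcal{M}$ are functional clones, i.e., $\langle\mathcal{E}\rangle=\mathcal{E}$ and $\langle\mathcal{M}\rangle=\mathcal{M}$.
   Context: $\mathcal{B}_k$ is the set of functions $\{0,1\}^k\to\mathbb{R}_{\ge0}$, $\mathcal{B}=\bigcup_k\mathcal{B}_k$. $\mathrm{EQ}\in\mathcal{B}_2$ is the binary equality indicator. For $\mathcal{F}\subseteq\mathcal{B}$, $\langle\mathcal{F}\rangle$ is the closure of $\mathcal{F}\cup\{\mathrm{EQ}\}$ under introducing fictitious arguments, permuting arguments, pointwise product of equal-arity functions, and summation $g(x_1,\dots,x_{k-1})=\sum_{x_k\in\{0,1\}}f(x_1,\dots,x_k)$. The Fourier transform of $f\in\mathcal{B}_k$ is $\widehat f(\mathbf{x})=2^{-k}\sum_{\mathbf{w}\in\{0,1\}^k}(-1)^{|\mathbf{w}\wedge\mathbf{x}|}f(\mathbf{w})$ ($|\cdot|$ = Hamming weight). An arity-$k$ match-circuit is an undirected graph with external vertices $u_1,\dots,u_k$ of degree 1 (incident edges $y_1,\dots,y_k$, called terminals, of weight 1) and internal vertices $v_1,\dots,v_n$ ($n\ge k$), each non-terminal edge $e$ having a weight $w_e>0$; it implements $f(y_1,\dots,y_k)=$ sum over edge sets $H$ containing exactly the terminals assigned 1 and meeting every internal vertex in exactly one edge, of $\prod_{e\in H}w_e$ (empty product 1). An even-circuit is the same except that non-terminal weights are in $(0,1]$ and the sum is over edge sets $H$ (terminals as prescribed) in which every internal vertex has even degree. $\mathcal{M}=\{f\in\mathcal{B}:\widehat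 f$ is implemented by some match-circuit$\}$; $\mathcal{E}$ is the set of functions $c\cdot f\in\mathcal{B}$ with $c\ge0$ real and $\widehat f$ implemented by some even-circuit. *)

theory Defs
  imports Complex_Main "HOL-Library.FuncSet" "HOL-Combinatorics.Permutations"
begin

text \<open>
  A function of arity \<open>k\<close> is a pair \<open>(k, f)\<close>, where \<open>f\<close> is extensional on the Boolean
  vectors of length \<open>k\<close> (so that equality of pairs is equality of functions on the cube).
  Arguments are indexed from 0, and arity 0 is allowed.
\<close>

type_synonym bfun = "bool list \<Rightarrow> real"

definition cube :: "nat \<Rightarrow> bool list set" where
  "cube k = {xs. length xs = k}"

definition nonneg_funs :: "nat \<Rightarrow> bfun set" where
  "nonneg_funs k = cube k \<rightarrow>\<^sub>E {0..}"

definition EQ :: bfun where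
  "EQ = (\<lambda>xs\<in>cube 2. of_bool (xs ! 0 = xs ! 1))"

text \<open>
  The closure \<open>\<langle>\<F>\<rangle>\<close>. A fictitious argument is added in the last position;
  together with \<open>permute\<close> this gives every position.
\<close>

inductive_set clone_closure :: "(nat \<times> bfun) set \<Rightarrow> (nat \<times> bfun) set"
  for \<F> :: "(nat \<times> bfun) set" where
  base: "(k, f) \<in> \<F> \<Longrightarrow> (k, f) \<in> clone_closure \<F>"
| eq: "(2, EQ) \<in> clone_closure \<F>"
| fictitious: "(k, f) \<in> clone_closure \<F> \<Longrightarrow>
    (Suc k, \<lambda>xs\<in>cube (Suc k). f (butlast xs)) \<in> clone_closure \<F>"
| permute: "(k, f) \<in> clone_closure \<F> \<Longrightarrow> \<pi> permutes {..<k} \<Longrightarrow>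
    (k, \<lambda>xs\<in>cube k. f (permute_list \<pi> xs)) \<in> clone_closure \<F>"
| product: "(k, f) \<in> clone_closure \<F> \<Longrightarrow> (k, g) \<in> clone_closure \<F> \<Longrightarrow>
    (k, \<lambda>xs\<in>cube k. f xs * g xs) \<in> clone_closure \<F>"
| summation: "(Suc k, f) \<in> clone_closure \<F> \<Longrightarrow>
    (k, \<lambda>xs\<in>cube k. \<Sum>b\<in>{False, True}. f (xs @ [b])) \<in> clone_closure \<F>"

definition hamming_weight :: "bool list \<Rightarrow> nat" where
  "hamming_weight xs = count_list xs True"

definition fourier :: "nat \<Rightarrow> bfun \<Rightarrow> bfun" where
  "fourier k f = (\<lambda>xs\<in>cube k.
     (1 / 2 ^ k) * (\<Sum>ws\<in>cube k. (-1) ^ hamming_weight (map2 (\<and>) ws xs) * f ws))"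

datatype vertex = Ext nat | Inn nat

text \<open>
  A weighted simple graph on the external vertices \<open>Ext 0, \<dots>, Ext (arity - 1)\<close> and the
  internal vertices \<open>Inn 0, \<dots>, Inn (inner - 1)\<close>; edges are two-element vertex sets.
\<close>

record circuit =
  arity :: nat
  inner :: nat
  edges :: "vertex set set"
  weight :: "vertex set \<Rightarrow> real"

definition vertices :: "circuit \<Rightarrow> vertex set" where
  "vertices C = Ext ` {..<arity C} \<union> Inn ` {..<inner C}"

definition degree :: "vertex set set \<Rightarrow> vertex \<Rightarrow> nat" where
  "degree H v = card {e \<in> H. v \<in> e}"

text \<open>Only meaningful if \<open>Ext i\<close> has degree 1.\<close>

definition terminal :: "circuit \<Rightarrow> nat \<Rightarrow> vertex set" where
  "terminal C i = (THE e. e \<in> edges C \<and> Ext i \<in> e)"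

definition terminals :: "circuit \<Rightarrow> vertex set set" where
  "terminals C = terminal C ` {..<arity C}"

text \<open>
  Injectivity says that the terminals are \<open>arity C\<close> different edges, so that they can be
  assigned independent Boolean values: no edge joins two external vertices.
\<close>

definition circuit_graph :: "circuit \<Rightarrow> bool" where
  "circuit_graph C \<longleftrightarrow>
     arity C \<le> inner C \<and>
     edges C \<subseteq> {e. e \<subseteq> vertices C \<and> card e = 2} \<and>
     (\<forall>i<arity C. degree (edges C) (Ext i) = 1) \<and>
     inj_on (terminal C) {..<arity C} \<and>
     (\<forall>e\<in>terminals C. weight C e = 1)"

definition match_circuit :: "circuit \<Rightarrow> bool" where
  "match_circuit C \<longleftrightarrow> circuit_graph C \<and>
     (\<forall>e\<in>edges C - terminals C. weight C e > 0)"

definition even_circuit :: "circuit \<Rightarrow> bool" where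
  "even_circuit C \<longleftrightarrow> circuit_graph C \<and>
     (\<forall>e\<in>edges C - terminals C. weight C e \<in> {0<..1})"

definition agrees_on_terminals :: "circuit \<Rightarrow> bool list \<Rightarrow> vertex set set \<Rightarrow> bool" where
  "agrees_on_terminals C ys H \<longleftrightarrow> (\<forall>i<arity C. terminal C i \<in> H \<longleftrightarrow> ys ! i)"

definition match_sets :: "circuit \<Rightarrow> bool list \<Rightarrow> vertex set set set" where
  "match_sets C ys = {H. H \<subseteq> edges C \<and> agrees_on_terminals C ys H \<and>
     (\<forall>j<inner C. degree H (Inn j) = 1)}"

definition even_sets :: "circuit \<Rightarrow> bool list \<Rightarrow> vertex set set set" where
  "even_sets C ys = {H. H \<subseteq> edges C \<and> agrees_on_terminals C ys H \<and>
     (\<forall>j<inner C. even (degree H (Inn j)))}"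

definition match_fun :: "circuit \<Rightarrow> bfun" where
  "match_fun C = (\<lambda>ys\<in>cube (arity C). \<Sum>H\<in>match_sets C ys. \<Prod>e\<in>H. weight C e)"

definition even_fun :: "circuit \<Rightarrow> bfun" where
  "even_fun C = (\<lambda>ys\<in>cube (arity C). \<Sum>H\<in>even_sets C ys. \<Prod>e\<in>H. weight C e)"

definition match_class :: "(nat \<times> bfun) set" where
  "match_class = {(k, f). f \<in> nonneg_funs k \<and>
     (\<exists>C. match_circuit C \<and> arity C = k \<and> match_fun C = fourier k f)}"

definition even_class :: "(nat \<times> bfun) set" where
  "even_class = {(k, \<lambda>xs\<in>cube k. c * f xs) | k c f. c \<ge> 0 \<and> f \<in> nonneg_funs k \<and>
     (\<exists>C. even_circuit C \<and> arity C = k \<and> even_fun C = fourier k f)}"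

end

(*
The Fourier transform turns the clone operations into operations on circuits: a fictitious argument
becomes an extra terminal that has to be off, summation over the last argument deletes a terminal,
and a pointwise product becomes a convolution. The convolution is obtained from the disjoint union
of two circuits by identifying arguments one pair at a time: setting the last argument equal to the
i-th one means replacing these two terminals by a new one whose value is their sum mod 2.
A triangle with one subdivided terminal edge does this for matchings and, up to a factor 2, also for
even subgraphs, so both classes are treated at once. Constant factors are harmless: an isolated edge
of weight c rescales a match-circuit, and even-circuits are rescaled by definition.
*)
theory Submission
  imports Defs
begin

section \<open>The Fourier transform on the cube\<close>

text \<open>Setting one argument equal to another restricts a function to a subgroup of the cube. On
  the Fourier side restriction is summation over the cosets of the annihilator, here
  \<open>{0, e_i + e_k}\<close>; hence the addition mod 2 at the identified terminals and the two
  summands. Even subgraphs filter by parity of their own accord, matchings do not. A triangle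
  supplies the parity check for matchings: the corners not matched from outside must be matched
  among themselves, so their number is even. All gadget edges have weight 1, which both weight
  ranges allow. The obstacle to a common treatment is that terminals are prescribed by membership
  and internal vertices by degree. An external vertex has a single incident edge, so membership is a
  degree condition too, and the value of a circuit becomes one sum with a degree constraint at every
  vertex. Union, deletion and gluing of circuits are then identities between such sums. Positive
  factors such as 2 and 1/2 arise on the way. They are kept apart from the coefficient
  \<open>c \<ge> 0\<close> of an even function, which may vanish.\<close>

lemma finite_cube [simp]: "finite (cube k)"
  using finite_lists_length_eq[of "UNIV :: bool set" k] by (simp add: cube_def)

lemma cube_0 [simp]: "cube 0 = {[]}"
  by (auto simp: cube_def)

lemma snoc_in_cube [simp]: "xs @ [b] \<in> cube (Suc k) \<longleftrightarrow> xs \<in> cube k"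
  by (simp add: cube_def)

lemma sum_cube_add:
  "(\<Sum>zs\<in>cube (k + l). \<phi> zs) = (\<Sum>xs\<in>cube k. \<Sum>ys\<in>cube l. \<phi> (xs @ ys))"
proof -
  have "(\<Sum>xs\<in>cube k. \<Sum>ys\<in>cube l. \<phi> (xs @ ys)) = (\<Sum>(xs, ys)\<in>cube k \<times> cube l. \<phi> (xs @ ys))"
    by (simp add: sum.cartesian_product)
  also have "\<dots> = (\<Sum>zs\<in>cube (k + l). \<phi> zs)"
    by (rule sum.reindex_bij_witness[where i = "\<lambda>zs. (take k zs, drop k zs)"
          and j = "\<lambda>(xs, ys). xs @ ys"]) (auto simp: cube_def)
  finally show ?thesis by simp
qed

lemma sum_cube_Suc:
  "(\<Sum>zs\<in>cube (Suc k). \<phi> zs) = (\<Sum>xs\<in>cube k. \<phi> (xs @ [False]) + \<phi> (xs @ [True]))"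
proof -
  have "cube 1 = {[False], [True]}"
    by (auto simp: cube_def length_Suc_conv)
  with sum_cube_add[of \<phi> k 1] show ?thesis by simp
qed

section \<open>Characters of the cube\<close>

definition character :: "bool list \<Rightarrow> bool list \<Rightarrow> real" where
  "character ws xs = (-1) ^ hamming_weight (map2 (\<and>) ws xs)"

lemma fourier_eq:
  "xs \<in> cube k \<Longrightarrow> fourier k f xs = (\<Sum>ws\<in>cube k. character ws xs * f ws) / 2 ^ k"
  by (simp add: fourier_def character_def)

lemma fourier_cong:
  "(\<And>xs. xs \<in> cube k \<Longrightarrow> f xs = g xs) \<Longrightarrow> fourier k f = fourier k g"
  unfolding fourier_def by (intro restrict_ext) simp

lemma fourier_scale: "xs \<in> cube k \<Longrightarrow> fourier k (\<lambda>ws. c * f ws) xs = c * fourier k f xs"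
  by (simp add: fourier_eq sum_distrib_left mult.left_commute)

lemma character_single [simp]: "character [a] [b] = (if a \<and> b then - 1 else 1)"
  by (simp add: character_def hamming_weight_def)

lemma character_append:
  "length ws = length xs \<Longrightarrow>
    character (ws @ ws') (xs @ xs') = character ws xs * character ws' xs'"
  by (simp add: character_def hamming_weight_def power_add)

text \<open>A product over positions, unlike the count of a zipped list, can be reindexed by a
  permutation or changed at a single position.\<close>

lemma character_conv_prod:
  assumes "length ws = length xs"
  shows "character ws xs = (\<Prod>i<length xs. if ws ! i \<and> xs ! i then - 1 else 1)"
  using assms
proof (induction ws xs rule: list_induct2)
  case Nil
  then show ?case by (simp add: character_def hamming_weight_def)
next
  case (Cons w ws x xs)
  have "character (w # ws) (x # xs) = character [w] [x] * character ws xs"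
    using character_append[of "[w]" "[x]" ws xs] by simp
  then show ?case
    by (simp add: Cons.IH prod.lessThan_Suc_shift del: prod.lessThan_Suc)
qed

lemma character_permute:
  assumes "\<pi> permutes {..<k}" "ws \<in> cube k" "xs \<in> cube k"
  shows "character (permute_list \<pi> ws) (permute_list \<pi> xs) = character ws xs"
proof -
  have "character (permute_list \<pi> ws) (permute_list \<pi> xs)
      = (\<Prod>i<k. if ws ! \<pi> i \<and> xs ! \<pi> i then - 1 else 1)"
    using assms by (simp add: character_conv_prod cube_def permute_list_nth)
  also have "\<dots> = (\<Prod>i<k. if ws ! i \<and> xs ! i then - 1 else 1)"
    using prod.permute[OF assms(1), of "\<lambda>i. if ws ! i \<and> xs ! i then - 1 else (1::real)"]
    by (simp add: o_def)
  also have "\<dots> = character ws xs"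
    using assms by (simp add: character_conv_prod cube_def)
  finally show ?thesis .
qed

text \<open>The updated list is the sum mod 2 of \<open>xs\<close> and \<open>b\<close> times the
  \<open>i\<close>-th unit vector, and characters are multiplicative.\<close>

lemma character_flip:
  assumes "length ws = length xs" "i < length xs"
  shows "character ws (xs[i := (xs ! i \<noteq> b)]) = (if ws ! i \<and> b then - 1 else 1) * character ws xs"
proof -
  let ?s = "if ws ! i \<and> b then - 1 else 1 :: real"
  have "character ws (xs[i := (xs ! i \<noteq> b)])
      = (\<Prod>j<length xs. (if j = i then ?s else 1) * (if ws ! j \<and> xs ! j then - 1 else 1))"
    using assms by (subst character_conv_prod) (auto intro!: prod.cong simp: nth_list_update)
  also have "\<dots> = ?s * character ws xs"
    using assms by (subst prod.distrib) (simp add: character_conv_prod)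
  finally show ?thesis .
qed

section \<open>Fourier transforms of the clone operations\<close>

lemma fourier_tensor:
  assumes "zs \<in> cube (k + l)"
  shows "fourier (k + l) (\<lambda>zs. f (take k zs) * g (drop k zs)) zs
    = fourier k f (take k zs) * fourier l g (drop k zs)"
proof -
  let ?x = "take k zs" and ?y = "drop k zs"
  have xy: "?x \<in> cube k" "?y \<in> cube l" using assms by (auto simp: cube_def)
  have ch: "character (ws @ vs) zs = character ws ?x * character vs ?y" if "ws \<in> cube k" for ws vs
    using character_append[of ws ?x vs ?y] that xy by (simp add: cube_def)
  have "(\<Sum>zs'\<in>cube (k + l). character zs' zs * (f (take k zs') * g (drop k zs')))
    = (\<Sum>ws\<in>cube k. \<Sum>vs\<in>cube l. (character ws ?x * f ws) * (character vs ?y * g vs))"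
    unfolding sum_cube_add by (intro sum.cong) (simp_all add: ch, simp add: cube_def)
  then show ?thesis
    using assms xy by (simp add: fourier_eq sum_product power_add)
qed

text \<open>A character whose last frequency is \<open>False\<close> ignores the last argument. The
  factor 2 is the quotient of the two normalisations.\<close>

lemma fourier_sum_last:
  assumes "xs \<in> cube k"
  shows "fourier k (\<lambda>xs. \<Sum>b\<in>{False, True}. f (xs @ [b])) xs = 2 * fourier (Suc k) f (xs @ [False])"
proof -
  have "character (ws @ [b]) (xs @ [False]) = character ws xs" if "ws \<in> cube k" for ws b
    using that assms by (simp add: character_append cube_def)
  then show ?thesis
    using assms by (simp add: fourier_eq sum_cube_Suc distrib_left)
qed

lemma fourier_permute:
  assumes "\<pi> permutes {..<k}" "xs \<in> cube k"
  shows "fourier k (\<lambda>xs. f (permute_list \<pi> xs)) xs = fourier k f (permute_list \<pi> xs)"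
proof -
  have "(\<Sum>ws\<in>cube k. character ws xs * f (permute_list \<pi> ws))
      = (\<Sum>ws\<in>cube k. character ws (permute_list \<pi> xs) * f ws)"
  proof (rule sum.reindex_bij_witness
      [where j = "permute_list \<pi>" and i = "permute_list (inv \<pi>)"])
    fix ws :: "bool list" assume ws: "ws \<in> cube k"
    then have \<pi>: "\<pi> permutes {..<length ws}" "inv \<pi> permutes {..<length ws}"
      using assms(1) by (simp_all add: cube_def permutes_inv)
    show "permute_list (inv \<pi>) (permute_list \<pi> ws) = ws"
      using permute_list_compose[OF \<pi>(2), of \<pi>] permutes_inv_o(1)[OF assms(1)] by simp
    show "permute_list \<pi> (permute_list (inv \<pi>) ws) = ws"
      using permute_list_compose[OF \<pi>(1), of "inv \<pi>"] permutes_inv_o(2)[OF assms(1)] by simp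
    show "permute_list \<pi> ws \<in> cube k" "permute_list (inv \<pi>) ws \<in> cube k"
      using ws by (simp_all add: cube_def)
    show "character (permute_list \<pi> ws) (permute_list \<pi> xs) * f (permute_list \<pi> ws) =
        character ws xs * f (permute_list \<pi> ws)"
      using character_permute[OF assms(1) ws assms(2)] by simp
  qed
  moreover have "permute_list \<pi> xs \<in> cube k" using assms(2) by (simp add: cube_def)
  ultimately show ?thesis using assms(2) by (simp add: fourier_eq)
qed

text \<open>On the right, \<open>xs\<close> followed by \<open>False\<close> is shifted by the two
  elements of the annihilator of the subgroup on which the last argument equals the
  \<open>i\<close>-th.\<close>

lemma fourier_diagonal:
  assumes "i < k" "xs \<in> cube k"
  shows "fourier k (\<lambda>xs. f (xs @ [xs ! i])) xs
    = (\<Sum>b\<in>{False, True}. fourier (Suc k) f (xs[i := (xs ! i \<noteq> b)] @ [b]))"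
proof -
  have ch: "character (ws @ [a]) (xs[i := (xs ! i \<noteq> b)] @ [b])
      = character ws xs * ((if ws ! i \<and> b then - 1 else 1) * (if a \<and> b then - 1 else 1))"
    if "ws \<in> cube k" for ws a b
  proof -
    have "character (ws @ [a]) (xs[i := (xs ! i \<noteq> b)] @ [b])
        = character ws (xs[i := (xs ! i \<noteq> b)]) * character [a] [b]"
      using that assms by (intro character_append) (simp add: cube_def)
    then show ?thesis
      using that assms character_flip[of ws xs i b] by (simp only: character_single) (simp add: cube_def)
  qed
  have mem: "xs[i := (xs ! i \<noteq> b)] \<in> cube k" for b using assms by (simp add: cube_def)
  have "(\<Sum>b\<in>{False, True}. fourier (Suc k) f (xs[i := (xs ! i \<noteq> b)] @ [b]))
    = (\<Sum>b\<in>{False, True}. (\<Sum>ws\<in>cube k.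
        character (ws @ [False]) (xs[i := (xs ! i \<noteq> b)] @ [b]) * f (ws @ [False]) +
        character (ws @ [True]) (xs[i := (xs ! i \<noteq> b)] @ [b]) * f (ws @ [True])) / 2 ^ Suc k)"
    using mem by (intro sum.cong refl) (simp only: fourier_eq snoc_in_cube sum_cube_Suc)
  \<comment> \<open>Orthogonality: summed over \<open>b\<close>, the two signs give 2 if the last
    argument equals \<open>ws ! i\<close> and 0 otherwise. This 2 later cancels one factor of
    \<open>2 ^ Suc k\<close>.\<close>
  also have "\<dots> = (\<Sum>ws\<in>cube k. 2 * (character ws xs * f (ws @ [ws ! i]))) / 2 ^ Suc k"
    unfolding sum_divide_distrib[symmetric] sum.swap[of _ _ "{False, True}"]
    by (intro arg_cong2[where f = "(/)"] sum.cong refl)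
      (simp add: ch[of _ _ False, simplified] ch[of _ _ True, simplified])
  also have "\<dots> = fourier k (\<lambda>xs. f (xs @ [xs ! i])) xs"
    using assms by (simp add: fourier_eq sum_distrib_left[symmetric])
  finally show ?thesis ..
qed

text \<open>The function is a tensor product of \<open>f\<close> with the constant 1 of arity 1,
  whose transform is the indicator of frequency 0.\<close>

lemma fourier_fictitious:
  assumes "xs \<in> cube (Suc k)"
  shows "fourier (Suc k) (\<lambda>xs. f (butlast xs)) xs
    = fourier k f (take k xs) * of_bool (\<not> drop k xs ! 0)"
proof -
  have "fourier (Suc k) (\<lambda>xs. f (butlast xs)) xs
      = fourier (k + 1) (\<lambda>xs. f (take k xs) * 1) xs"
    by (subst fourier_cong[where g = "\<lambda>xs. f (take k xs)"]) (auto simp: cube_def butlast_conv_take)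
  also have "\<dots> = fourier k f (take k xs) * fourier 1 (\<lambda>_. 1) (drop k xs)"
    using assms by (subst fourier_tensor[where g = "\<lambda>_. 1"]) simp_all
  also have "fourier 1 (\<lambda>_. 1) (drop k xs) = of_bool (\<not> drop k xs ! 0)"
  proof -
    have "length (drop k xs) = Suc 0" using assms by (simp add: cube_def)
    then obtain b where "drop k xs = [b]" by (simp only: length_Suc_conv) auto
    then show ?thesis
      using snoc_in_cube[of "[]" b 0] by (simp add: fourier_eq sum_cube_Suc)
  qed
  finally show ?thesis .
qed

text \<open>The diagonal of the square is its own annihilator; the constant is its share 2/4 of the
  points.\<close>

lemma fourier_EQ:
  assumes "xs \<in> cube 2"
  shows "fourier 2 EQ xs = of_bool (xs ! 0 = xs ! 1) / 2"
proof -
  obtain a b where xs: "xs = [a, b]"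
    using assms by (auto simp: cube_def length_Suc_conv numeral_2_eq_2)
  have ch: "character [c, d] [a, b] = character [c] [a] * character [d] [b]" for c d
    using character_append[of "[c]" "[a]" "[d]" "[b]"] by simp
  have "(\<Sum>zs\<in>cube 2. \<phi> zs) = \<phi> [False, False] + \<phi> [False, True] + \<phi> [True, False] + \<phi> [True, True]"
    for \<phi> :: "bool list \<Rightarrow> real"
    unfolding numeral_2_eq_2 sum_cube_Suc by simp
  then show ?thesis
    using assms unfolding xs by (simp add: fourier_eq ch EQ_def cube_def)
qed

section \<open>Sums over edge sets with degree constraints\<close>

text \<open>The partition function of a Holant problem. \<open>V\<close> and \<open>E\<close> are
  independent parameters, so that a vertex can leave the constraints while the edges stay; a factor
  \<open>of_bool\<close> instead of a filtered index set lets sums range over full power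
  sets.\<close>

definition holant ::
  "vertex set \<Rightarrow> vertex set set \<Rightarrow> (vertex set \<Rightarrow> real) \<Rightarrow> (vertex \<Rightarrow> nat \<Rightarrow> bool) \<Rightarrow> real" where
  "holant V E w Q = (\<Sum>H\<in>Pow E. of_bool (\<forall>v\<in>V. Q v (degree H v)) * (\<Prod>e\<in>H. w e))"

lemma degree_empty [simp]: "degree {} v = 0"
  by (simp add: degree_def)

lemma degree_insert:
  assumes "finite H" "e \<notin> H"
  shows "degree (insert e H) v = degree H v + of_bool (v \<in> e)"
proof -
  have "{e' \<in> insert e H. v \<in> e'} = (if v \<in> e then insert e {e' \<in> H. v \<in> e'} else {e' \<in> H. v \<in> e'})"
    by auto
  then show ?thesis using assms by (simp add: degree_def)
qed

lemma degree_Un: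
  assumes "finite H" "finite X" "H \<inter> X = {}"
  shows "degree (H \<union> X) v = degree H v + degree X v"
proof -
  have eq: "{e \<in> H \<union> X. v \<in> e} = {e \<in> H. v \<in> e} \<union> {e \<in> X. v \<in> e}" by auto
  have "{e \<in> H. v \<in> e} \<inter> {e \<in> X. v \<in> e} = {}" using assms(3) by auto
  then show ?thesis
    unfolding degree_def eq using assms(1,2) by (intro card_Un_disjoint) simp_all
qed

lemma degree_mono: "finite E \<Longrightarrow> H \<subseteq> E \<Longrightarrow> degree H v \<le> degree E v"
  unfolding degree_def by (intro card_mono) auto

lemma degree_eq_0: "(\<And>e. e \<in> H \<Longrightarrow> v \<notin> e) \<Longrightarrow> degree H v = 0"
proof -
  assume "\<And>e. e \<in> H \<Longrightarrow> v \<notin> e"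
  then have "{e \<in> H. v \<in> e} = {}" by blast
  then show ?thesis by (simp only: degree_def card.empty)
qed

lemma degree_image:
  assumes "inj \<rho>"
  shows "degree ((`) \<rho> ` H) (\<rho> v) = degree H v"
proof -
  have "{e \<in> (`) \<rho> ` H. \<rho> v \<in> e} = (`) \<rho> ` {e \<in> H. v \<in> e}"
    using inj_image_mem_iff[OF assms] by blast
  moreover have "inj_on ((`) \<rho>) A" for A
    using assms by (simp add: inj_on_def inj_image_eq_iff)
  ultimately show ?thesis by (simp add: degree_def card_image)
qed

text \<open>Only degrees up to \<open>degree E v\<close> can occur. At a leaf just 0 and 1 matter,
  so there any constraint can be exchanged for one with the same values at 0 and 1.\<close>

lemma holant_cong:
  assumes "finite E"
    and "\<And>v d. v \<in> V \<Longrightarrow> d \<le> degree E v \<Longrightarrow> Q v d \<longleftrightarrow> Q' v d"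
    and "\<And>e. e \<in> E \<Longrightarrow> w e = w' e"
  shows "holant V E w Q = holant V E w' Q'"
  unfolding holant_def
proof (rule sum.cong[OF refl])
  fix H assume "H \<in> Pow E"
  then have "degree H v \<le> degree E v" "(\<Prod>e\<in>H. w e) = (\<Prod>e\<in>H. w' e)" for v
    using assms degree_mono by (auto intro!: prod.cong)
  then show "of_bool (\<forall>v\<in>V. Q v (degree H v)) * prod w H = of_bool (\<forall>v\<in>V. Q' v (degree H v)) * prod w' H"
    using assms(2) by simp
qed

lemma holant_eq_0: "v \<in> V \<Longrightarrow> (\<And>d. \<not> Q v d) \<Longrightarrow> holant V E w Q = 0"
  unfolding holant_def by (intro sum.neutral) auto

lemma holant_isolated:
  assumes "\<And>e. e \<in> E \<Longrightarrow> v \<notin> e"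
  shows "holant (insert v V) E w Q = of_bool (Q v 0) * holant V E w Q"
  unfolding holant_def sum_distrib_left
proof (rule sum.cong[OF refl])
  fix H assume "H \<in> Pow E"
  then have "degree H v = 0" using assms by (intro degree_eq_0) auto
  then show "of_bool (\<forall>u\<in>insert v V. Q u (degree H u)) * prod w H =
      of_bool (Q v 0) * (of_bool (\<forall>u\<in>V. Q u (degree H u)) * prod w H)"
    by simp
qed

lemma sum_Pow_Un:
  assumes "A \<inter> B = {}"
  shows "(\<Sum>H\<in>Pow (A \<union> B). \<phi> H) = (\<Sum>X\<in>Pow B. \<Sum>H\<in>Pow A. \<phi> (H \<union> X))"
proof -
  have "(\<Sum>X\<in>Pow B. \<Sum>H\<in>Pow A. \<phi> (H \<union> X)) = (\<Sum>(X, H)\<in>Pow B \<times> Pow A. \<phi> (H \<union> X))"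
    by (simp add: sum.cartesian_product)
  also have "\<dots> = (\<Sum>H\<in>Pow (A \<union> B). \<phi> H)"
    by (rule sum.reindex_bij_witness[where i = "\<lambda>H. (H \<inter> B, H \<inter> A)" and j = "\<lambda>(X, H). H \<union> X"])
      (use assms in auto)
  finally show ?thesis by simp
qed

lemma sum_Pow_insert:
  assumes "a \<notin> A"
  shows "(\<Sum>H\<in>Pow (insert a A). \<phi> H) = (\<Sum>H\<in>Pow A. \<phi> H) + (\<Sum>H\<in>Pow A. \<phi> (insert a H))"
  using sum_Pow_Un[of A "{a}" \<phi>] assms by (simp add: Pow_insert add.commute)

text \<open>Condition on the set \<open>X\<close> of chosen new edges: it contributes its weight and
  shifts the degree seen by every constraint.\<close>

lemma holant_add_edges:
  assumes "finite E" "finite G" "E \<inter> G = {}"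
  shows "holant V (E \<union> G) w Q
    = (\<Sum>X\<in>Pow G. (\<Prod>e\<in>X. w e) * holant V E w (\<lambda>v d. Q v (d + degree X v)))"
  unfolding holant_def sum_Pow_Un[OF assms(3)] sum_distrib_left
proof (intro sum.cong refl)
  fix X H assume "X \<in> Pow G" "H \<in> Pow E"
  then have *: "finite H" "finite X" "H \<inter> X = {}"
    using assms by (auto intro: finite_subset)
  then show "of_bool (\<forall>v\<in>V. Q v (degree (H \<union> X) v)) * prod w (H \<union> X) =
      prod w X * (of_bool (\<forall>v\<in>V. Q v (degree H v + degree X v)) * prod w H)"
    by (simp add: degree_Un prod.union_disjoint)
qed

lemma Pow_families_disjoint:
  assumes "A \<subseteq> Pow V" "B \<subseteq> Pow W" "V \<inter> W = {}" "{} \<notin> A"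
  shows "A \<inter> B = {}"
proof (rule ccontr)
  assume "A \<inter> B \<noteq> {}"
  then obtain e where e: "e \<in> A" "e \<in> B" by auto
  then have "e \<subseteq> V \<inter> W" using assms(1,2) by auto
  with e(1) assms(3,4) show False by simp
qed

lemma holant_disjoint_Un:
  assumes "finite E\<^sub>1" "finite E\<^sub>2" "E\<^sub>1 \<subseteq> Pow V\<^sub>1" "E\<^sub>2 \<subseteq> Pow V\<^sub>2" "V\<^sub>1 \<inter> V\<^sub>2 = {}" "{} \<notin> E\<^sub>1"
  shows "holant (V\<^sub>1 \<union> V\<^sub>2) (E\<^sub>1 \<union> E\<^sub>2) w Q = holant V\<^sub>1 E\<^sub>1 w Q * holant V\<^sub>2 E\<^sub>2 w Q"
proof -
  have disj: "E\<^sub>1 \<inter> E\<^sub>2 = {}" by (rule Pow_families_disjoint) (fact assms)+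
  show ?thesis
    unfolding holant_def sum_Pow_Un[OF disj] sum_product
      sum.swap[of _ "Pow E\<^sub>1" "Pow E\<^sub>2"]
  proof (intro sum.cong refl)
    fix X H assume XH: "X \<in> Pow E\<^sub>2" "H \<in> Pow E\<^sub>1"
    then have *: "finite H" "finite X" "H \<inter> X = {}"
      using assms disj by (auto intro: finite_subset)
    have "degree X v = 0" if "v \<in> V\<^sub>1" for v
      using that assms XH by (intro degree_eq_0) blast
    moreover have "degree H v = 0" if "v \<in> V\<^sub>2" for v
      using that assms XH by (intro degree_eq_0) blast
    ultimately show "of_bool (\<forall>v\<in>V\<^sub>1 \<union> V\<^sub>2. Q v (degree (H \<union> X) v)) * prod w (H \<union> X) =
        of_bool (\<forall>v\<in>V\<^sub>1. Q v (degree H v)) * prod w H *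
        (of_bool (\<forall>v\<in>V\<^sub>2. Q v (degree X v)) * prod w X)"
      using * by (simp add: degree_Un prod.union_disjoint ball_Un)
  qed
qed

text \<open>The preimage under the injective \<open>\<rho>\<close> undoes the image, so it carries
  the weights over to the renamed edges.\<close>

lemma holant_relabel:
  assumes "inj \<rho>"
  shows "holant (\<rho> ` V) ((`) \<rho> ` E) (\<lambda>e. w (\<rho> -` e)) Q = holant V E w (\<lambda>v. Q (\<rho> v))"
proof -
  have inj: "inj_on ((`) \<rho>) A" for A
    using assms by (simp add: inj_on_def inj_image_eq_iff)
  then have "inj_on ((`) ((`) \<rho>)) (Pow E)"
    by (simp add: inj_on_image_Pow)
  then show ?thesis
    unfolding holant_def
    by (simp flip: image_Pow_surj[OF refl]
        add: sum.reindex prod.reindex[OF inj] degree_image[OF assms] inj_vimage_image_eq[OF assms])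
qed

lemma holant_delete_leaf:
  assumes "finite E" "v \<notin> V" "{e \<in> E. v \<in> e} = {t}" "\<And>d. Q v d \<longleftrightarrow> d = 0"
  shows "holant (insert v V) E w Q = holant V (E - {t}) w Q"
proof -
  have t: "t \<in> E" "v \<in> t" using assms(3) by auto
  then have "E = (E - {t}) \<union> {t}" by auto
  then have "holant (insert v V) E w Q = holant (insert v V) ((E - {t}) \<union> {t}) w Q" by simp
  also have "\<dots> = holant (insert v V) (E - {t}) w Q +
      w t * holant (insert v V) (E - {t}) w (\<lambda>u d. Q u (d + degree {t} u))"
    using assms(1) by (subst holant_add_edges) (auto simp: Pow_insert)
  also have "holant (insert v V) (E - {t}) w (\<lambda>u d. Q u (d + degree {t} u)) = 0"
    using t assms(4) by (intro holant_eq_0[of v]) (auto simp: degree_insert)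
  also have "holant (insert v V) (E - {t}) w Q = holant V (E - {t}) w Q"
    using assms(3,4) by (subst holant_isolated) auto
  finally show ?thesis by simp
qed

section \<open>Weighted graphs with external leaves\<close>

definition vertex_set :: "nat \<Rightarrow> nat \<Rightarrow> vertex set" where
  "vertex_set k n = Ext ` {..<k} \<union> Inn ` {..<n}"

text \<open>A form of \<open>circuit_graph\<close> free of \<open>THE\<close>: that terminals are
  distinct edges is expressed by their inner endpoints. \<open>W\<close> bounds the weights of all
  edges, terminals included, which agrees with the circuit definitions as long as
  \<open>1 \<in> W\<close>.\<close>

definition terminal_graph ::
  "real set \<Rightarrow> nat \<Rightarrow> nat \<Rightarrow> vertex set set \<Rightarrow> (vertex set \<Rightarrow> real) \<Rightarrow> bool" where
  "terminal_graph W k n E w \<longleftrightarrow> k \<le> n \<and> E \<subseteq> {e. e \<subseteq> vertex_set k n \<and> card e = 2} \<and>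
     (\<forall>i<k. \<exists>j. {e \<in> E. Ext i \<in> e} = {{Ext i, Inn j}}) \<and>
     (\<forall>e\<in>E. w e \<in> W) \<and> (\<forall>i<k. \<forall>e\<in>E. Ext i \<in> e \<longrightarrow> w e = 1)"

section \<open>Functions implemented by circuits\<close>

text \<open>
  The prescribed values of the terminals are treated as degree constraints at the external vertices.
\<close>

definition constraint :: "(nat \<Rightarrow> bool) \<Rightarrow> bool list \<Rightarrow> vertex \<Rightarrow> nat \<Rightarrow> bool" where
  "constraint P y v = (case v of Ext i \<Rightarrow> (\<lambda>d. d = of_bool (y ! i)) | Inn j \<Rightarrow> P)"

lemma constraint_simps [simp]:
  "constraint P y (Ext i) d \<longleftrightarrow> d = of_bool (y ! i)"
  "constraint P y (Inn j) d \<longleftrightarrow> P d"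
  by (simp_all add: constraint_def)

text \<open>\<open>P\<close> is the degree condition at internal vertices. \<open>F\<close> is
  compared on the cube only, so it can be written without \<open>restrict\<close>.\<close>

definition implements :: "(nat \<Rightarrow> bool) \<Rightarrow> real set \<Rightarrow> nat \<Rightarrow> bfun \<Rightarrow> bool" where
  "implements P W k F \<longleftrightarrow> (\<exists>n E w. terminal_graph W k n E w \<and>
     (\<forall>y\<in>cube k. F y = holant (vertex_set k n) E w (constraint P y)))"

lemma finite_vertex_set [simp]: "finite (vertex_set k n)"
  by (simp add: vertex_set_def)

lemma terminal_graphD:
  assumes "terminal_graph W k n E w"
  shows "finite E" "E \<subseteq> Pow (vertex_set k n)" "{} \<notin> E" "k \<le> n"
    "\<And>e. e \<in> E \<Longrightarrow> w e \<in> W" "\<And>e. e \<in> E \<Longrightarrow> card e = 2"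
    "\<And>i e. i < k \<Longrightarrow> e \<in> E \<Longrightarrow> Ext i \<in> e \<Longrightarrow> w e = 1"
proof -
  show "E \<subseteq> Pow (vertex_set k n)" using assms by (auto simp: terminal_graph_def)
  then show "finite E" by (rule finite_subset) simp
qed (use assms in \<open>auto simp: terminal_graph_def\<close>)

lemma terminal_graph_leaf:
  assumes "terminal_graph W k n E w" "i < k"
  obtains j where "j < n" "{e \<in> E. Ext i \<in> e} = {{Ext i, Inn j}}"
proof -
  obtain j where j: "{e \<in> E. Ext i \<in> e} = {{Ext i, Inn j}}"
    using assms by (auto simp: terminal_graph_def)
  then have "{Ext i, Inn j} \<subseteq> vertex_set k n"
    using terminal_graphD(2)[OF assms(1)] by blast
  then show thesis using that[OF _ j] by (auto simp: vertex_set_def)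
qed

text \<open>Shifting the external vertices of the second circuit by \<open>k\<close> makes its
  terminals read \<open>drop k y\<close>; with no edge between the two parts the sum
  factors.\<close>

lemma implements_tensor:
  assumes "implements P W k F" "implements P W l G"
  shows "implements P W (k + l) (\<lambda>y. F (take k y) * G (drop k y))"
proof -
  obtain n E w where C: "terminal_graph W k n E w"
    and F: "\<And>y. y \<in> cube k \<Longrightarrow> F y = holant (vertex_set k n) E w (constraint P y)"
    using assms(1) by (auto simp: implements_def)
  obtain n' E' w' where C': "terminal_graph W l n' E' w'"
    and G: "\<And>y. y \<in> cube l \<Longrightarrow> G y = holant (vertex_set l n') E' w' (constraint P y)"
    using assms(2) by (auto simp: implements_def)
  define \<rho> where "\<rho> v = (case v of Ext i \<Rightarrow> Ext (i + k) | Inn j \<Rightarrow> Inn (j + n))" for v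
  have inj: "inj \<rho>" by (auto simp: \<rho>_def inj_def split: vertex.splits)
  have \<rho>_simps [simp]: "\<rho> (Ext i) = Ext (i + k)" "\<rho> (Inn j) = Inn (j + n)" for i j
    by (simp_all add: \<rho>_def)
  define V\<^sub>2 E\<^sub>2 where "V\<^sub>2 = \<rho> ` vertex_set l n'" and "E\<^sub>2 = (`) \<rho> ` E'"
  define u where "u e = (if e \<in> E then w e else w' (\<rho> -` e))" for e
  have V: "vertex_set (k + l) (n + n') = vertex_set k n \<union> V\<^sub>2"
  proof -
    have "{..<k + l} = {..<k} \<union> (\<lambda>i. i + k) ` {..<l}" for k l :: nat
      using image_add_atLeastLessThan'[of k 0 l]
      by (simp add: atLeast0LessThan ivl_disj_un_one(2) add.commute)
    then show ?thesis
      by (simp only: V\<^sub>2_def vertex_set_def image_Un image_image \<rho>_simps) auto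
  qed
  have disj: "vertex_set k n \<inter> V\<^sub>2 = {}"
    by (auto simp: V\<^sub>2_def vertex_set_def)
  have E\<^sub>2: "E\<^sub>2 \<subseteq> Pow V\<^sub>2" "finite E\<^sub>2" "{} \<notin> E\<^sub>2"
    using terminal_graphD[OF C'] by (auto simp: V\<^sub>2_def E\<^sub>2_def)
  have EE: "E \<inter> E\<^sub>2 = {}"
    by (rule Pow_families_disjoint[OF terminal_graphD(2)[OF C] E\<^sub>2(1) disj terminal_graphD(3)[OF C]])
  have u2: "u (\<rho> ` e) = w' e" if "e \<in> E'" for e
  proof -
    have "\<rho> ` e \<in> E\<^sub>2" using that by (simp add: E\<^sub>2_def)
    then show ?thesis using EE by (auto simp: u_def inj_vimage_image_eq[OF inj])
  qed
  have "terminal_graph W (k + l) (n + n') (E \<union> E\<^sub>2) u"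
    unfolding terminal_graph_def
  proof (intro conjI allI impI ballI)
    show "k + l \<le> n + n'" using terminal_graphD(4)[OF C] terminal_graphD(4)[OF C'] by simp
    have "card e = 2" if "e \<in> E\<^sub>2" for e
      using that terminal_graphD(6)[OF C'] inj by (auto simp: E\<^sub>2_def card_image inj_on_def)
    then show "E \<union> E\<^sub>2 \<subseteq> {e. e \<subseteq> vertex_set (k + l) (n + n') \<and> card e = 2}"
      using terminal_graphD(2,6)[OF C] E\<^sub>2(1) unfolding V by auto
    show "u e \<in> W" if "e \<in> E \<union> E\<^sub>2" for e
      using that terminal_graphD(5)[OF C] terminal_graphD(5)[OF C']
      by (auto simp: u_def E\<^sub>2_def inj_vimage_image_eq[OF inj])
    fix i assume i: "i < k + l"
    show "\<exists>j. {e \<in> E \<union> E\<^sub>2. Ext i \<in> e} = {{Ext i, Inn j}}"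
    proof (cases "i < k")
      case True
      obtain j where j: "{e \<in> E. Ext i \<in> e} = {{Ext i, Inn j}}"
        using terminal_graph_leaf[OF C True] .
      have "Ext i \<notin> V\<^sub>2" using True disj by (auto simp: vertex_set_def)
      then have "{e \<in> E \<union> E\<^sub>2. Ext i \<in> e} = {e \<in> E. Ext i \<in> e}" using E\<^sub>2 by auto
      then show ?thesis using j by (intro exI[of _ j]) (simp only:)
    next
      case False
      then obtain i' where i': "i = i' + k" "i' < l"
        using i by (metis add.commute le_add_diff_inverse2 nat_add_left_cancel_less not_less)
      obtain j where j: "{e \<in> E'. Ext i' \<in> e} = {{Ext i', Inn j}}"
        using terminal_graph_leaf[OF C' i'(2)] .
      have "Ext i \<notin> vertex_set k n" using i' by (auto simp: vertex_set_def)
      then have "{e \<in> E \<union> E\<^sub>2. Ext i \<in> e} = {e \<in> E\<^sub>2. \<rho> (Ext i') \<in> e}"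
        using terminal_graphD(2)[OF C] i' by auto
      also have "\<dots> = (`) \<rho> ` {e \<in> E'. Ext i' \<in> e}"
        unfolding E\<^sub>2_def using inj_image_mem_iff[OF inj] by blast
      finally show ?thesis using i' j by auto
    qed
    fix e assume e: "e \<in> E \<union> E\<^sub>2" "Ext i \<in> e"
    show "u e = 1"
    proof (cases "e \<in> E")
      case True
      then have "i < k" using terminal_graphD(2)[OF C] e by (auto simp: vertex_set_def)
      then show ?thesis using True e terminal_graphD(7)[OF C] by (auto simp: u_def)
    next
      case False
      then obtain e' where e': "e = \<rho> ` e'" "e' \<in> E'" using e by (auto simp: E\<^sub>2_def)
      then obtain v where v: "Ext i = \<rho> v" "v \<in> e'" using e(2) by auto
      have "v \<in> vertex_set l n'" using e'(2) v(2) terminal_graphD(2)[OF C'] by blast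
      then obtain i' where "v = Ext i'" "i' < l"
        using v(1) by (auto simp: vertex_set_def)
      then show ?thesis using e' v u2 terminal_graphD(7)[OF C'] by auto
    qed
  qed
  moreover have "F (take k y) * G (drop k y) = holant (vertex_set (k + l) (n + n')) (E \<union> E\<^sub>2) u (constraint P y)"
    if y: "y \<in> cube (k + l)" for y
  proof -
    have "holant (vertex_set (k + l) (n + n')) (E \<union> E\<^sub>2) u (constraint P y)
      = holant (vertex_set k n) E u (constraint P y) * holant V\<^sub>2 E\<^sub>2 u (constraint P y)"
      unfolding V using disj E\<^sub>2 terminal_graphD[OF C] by (intro holant_disjoint_Un) auto
    also have "holant (vertex_set k n) E u (constraint P y) = F (take k y)"
      using y terminal_graphD(1)[OF C]
      by (subst F) (auto simp: cube_def u_def vertex_set_def intro!: holant_cong)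
    also have "holant V\<^sub>2 E\<^sub>2 u (constraint P y) = holant V\<^sub>2 E\<^sub>2 (\<lambda>e. w' (\<rho> -` e)) (constraint P y)"
      using E\<^sub>2 EE by (intro holant_cong) (auto simp: u_def)
    also have "\<dots> = holant (vertex_set l n') E' w' (\<lambda>v. constraint P y (\<rho> v))"
      unfolding V\<^sub>2_def E\<^sub>2_def by (rule holant_relabel[OF inj])
    also have "\<dots> = G (drop k y)"
      using y terminal_graphD(1)[OF C']
      by (subst G) (auto simp: cube_def vertex_set_def add.commute intro!: holant_cong)
    finally show ?thesis ..
  qed
  ultimately show ?thesis unfolding implements_def by blast
qed

text \<open>After renaming \<open>Ext i\<close> to \<open>Ext (\<pi> i)\<close> its terminal reads
  \<open>y ! \<pi> i\<close>, which is \<open>permute_list \<pi> y ! i\<close>. Since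
  \<open>\<pi>\<close> fixes all indices from \<open>k\<close> on, the renaming is injective on all
  vertices.\<close>

lemma implements_permute:
  assumes "implements P W k F" and \<pi>: "\<pi> permutes {..<k}"
  shows "implements P W k (\<lambda>y. F (permute_list \<pi> y))"
proof -
  obtain n E w where C: "terminal_graph W k n E w"
    and F: "\<And>y. y \<in> cube k \<Longrightarrow> F y = holant (vertex_set k n) E w (constraint P y)"
    using assms(1) by (auto simp: implements_def)
  define \<rho> where "\<rho> v = (case v of Ext i \<Rightarrow> Ext (\<pi> i) | Inn j \<Rightarrow> Inn j)" for v
  have inj: "inj \<rho>"
    using permutes_inj[OF \<pi>] by (auto simp: \<rho>_def inj_def split: vertex.splits)
  have \<rho>_simps [simp]: "\<rho> (Ext i) = Ext (\<pi> i)" "\<rho> (Inn j) = Inn j" for i j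
    by (simp_all add: \<rho>_def)
  define E' u where "E' = (`) \<rho> ` E" and "u e = w (\<rho> -` e)" for e
  have u: "u (\<rho> ` e) = w e" for e by (simp add: u_def inj_vimage_image_eq[OF inj])
  have V: "\<rho> ` vertex_set k n = vertex_set k n"
  proof -
    have "Ext ` \<pi> ` {..<k} \<union> Inn ` {..<n} = Ext ` {..<k} \<union> Inn ` {..<n}"
      by (simp add: permutes_image[OF \<pi>])
    then show ?thesis by (simp add: vertex_set_def image_Un image_image)
  qed
  have "terminal_graph W k n E' u"
    unfolding terminal_graph_def
  proof (intro conjI allI impI ballI)
    show "k \<le> n" using terminal_graphD[OF C] by simp
    have "card e = 2 \<and> e \<subseteq> vertex_set k n" if e: "e \<in> E'" for e
    proof -
      obtain e' where e': "e = \<rho> ` e'" "e' \<in> E" using e by (auto simp: E'_def)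
      then have "\<rho> ` e' \<subseteq> \<rho> ` vertex_set k n"
        using terminal_graphD(2)[OF C] by (intro image_mono) auto
      then show ?thesis
        using e' terminal_graphD(6)[OF C] V by (simp add: card_image inj_on_subset[OF inj])
    qed
    then show "E' \<subseteq> {e. e \<subseteq> vertex_set k n \<and> card e = 2}" by auto
    show "u e \<in> W" if "e \<in> E'" for e
      using that terminal_graphD(5)[OF C] by (auto simp: u E'_def)
    fix i assume i: "i < k"
    then obtain i' where i': "i = \<pi> i'" "i' < k"
      using permutes_image[OF \<pi>] by (metis imageE lessThan_iff)
    show "\<exists>j. {e \<in> E'. Ext i \<in> e} = {{Ext i, Inn j}}"
    proof -
      obtain j where j: "{e \<in> E. Ext i' \<in> e} = {{Ext i', Inn j}}"
        using terminal_graph_leaf[OF C i'(2)] .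
      have "{e \<in> E'. Ext i \<in> e} = {e \<in> E'. \<rho> (Ext i') \<in> e}"
        by (simp add: i')
      also have "\<dots> = (`) \<rho> ` {e \<in> E. Ext i' \<in> e}"
        unfolding E'_def using inj_image_mem_iff[OF inj] by blast
      finally show ?thesis using i' j by auto
    qed
    fix e assume e: "e \<in> E'" "Ext i \<in> e"
    then obtain e' where e': "e = \<rho> ` e'" "e' \<in> E" by (auto simp: E'_def)
    then have "Ext i' \<in> e'"
      using e(2) inj_image_mem_iff[OF inj, of "Ext i'" e'] by (simp add: i')
    then show "u e = 1" using e' i' u terminal_graphD(7)[OF C] by auto
  qed
  moreover have "F (permute_list \<pi> y) = holant (vertex_set k n) E' u (constraint P y)"
    if y: "y \<in> cube k" for y
  proof -
    have "holant (vertex_set k n) E' u (constraint P y)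
        = holant (vertex_set k n) E w (\<lambda>v. constraint P y (\<rho> v))"
      unfolding E'_def u_def using holant_relabel[OF inj, of "vertex_set k n"] V by simp
    also have "\<dots> = F (permute_list \<pi> y)"
      using y terminal_graphD(1)[OF C] \<pi>
      by (subst F) (auto simp: cube_def vertex_set_def permute_list_nth intro!: holant_cong)
    finally show ?thesis ..
  qed
  ultimately show ?thesis unfolding implements_def by blast
qed

text \<open>A terminal assigned \<open>False\<close> lies in no admissible edge set, so it is
  deleted together with its external vertex. The internal vertices stay, which preserves the bound
  on the arity.\<close>

lemma implements_pin:
  assumes "implements P W (Suc k) F"
  shows "implements P W k (\<lambda>y. F (y @ [False]))"
proof -
  obtain n E w where C: "terminal_graph W (Suc k) n E w"
    and F: "\<And>y. y \<in> cube (Suc k) \<Longrightarrow> F y = holant (vertex_set (Suc k) n) E w (constraint P y)"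
    using assms(1) by (auto simp: implements_def)
  obtain j where j: "{e \<in> E. Ext k \<in> e} = {{Ext k, Inn j}}"
    using terminal_graph_leaf[OF C, of k] by auto
  define t where "t = {Ext k, Inn j}"
  have t: "e = t \<longleftrightarrow> Ext k \<in> e" if "e \<in> E" for e
    using that j by (auto simp: t_def)
  have V: "vertex_set (Suc k) n = insert (Ext k) (vertex_set k n)"
    by (auto simp: vertex_set_def lessThan_Suc)
  have "terminal_graph W k n (E - {t}) w"
    unfolding terminal_graph_def
  proof (intro conjI allI impI ballI)
    show "k \<le> n" using terminal_graphD(4)[OF C] by simp
    show "E - {t} \<subseteq> {e. e \<subseteq> vertex_set k n \<and> card e = 2}"
      using terminal_graphD(2,6)[OF C] t unfolding V by auto
    show "w e \<in> W" if "e \<in> E - {t}" for e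
      using that terminal_graphD(5)[OF C] by auto
    fix i assume i: "i < k"
    show "\<exists>j. {e \<in> E - {t}. Ext i \<in> e} = {{Ext i, Inn j}}"
    proof -
      obtain j' where "{e \<in> E. Ext i \<in> e} = {{Ext i, Inn j'}}"
        using terminal_graph_leaf[OF C, of i] i by auto
      moreover have "{e \<in> E - {t}. Ext i \<in> e} = {e \<in> E. Ext i \<in> e}"
        using i by (auto simp: t_def)
      ultimately show ?thesis by auto
    qed
    show "w e = 1" if "e \<in> E - {t}" "Ext i \<in> e" for e
      using that(1,2) i by (intro terminal_graphD(7)[OF C, of i e]) simp_all
  qed
  moreover have "F (y @ [False]) = holant (vertex_set k n) (E - {t}) w (constraint P y)"
    if y: "y \<in> cube k" for y
  proof -
    have "F (y @ [False]) = holant (insert (Ext k) (vertex_set k n)) E w (constraint P (y @ [False]))"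
      using y by (simp add: F V)
    also have "\<dots> = holant (vertex_set k n) (E - {t}) w (constraint P (y @ [False]))"
    proof (rule holant_delete_leaf)
      show "finite E" by (rule terminal_graphD(1)[OF C])
      show "Ext k \<notin> vertex_set k n" by (auto simp: vertex_set_def)
      show "{e \<in> E. Ext k \<in> e} = {t}" unfolding t_def by (rule j)
      show "constraint P (y @ [False]) (Ext k) d \<longleftrightarrow> d = 0" for d
        using y by (simp add: cube_def nth_append)
    qed
    also have "\<dots> = holant (vertex_set k n) (E - {t}) w (constraint P y)"
      using y terminal_graphD(1)[OF C]
      by (intro holant_cong) (auto simp: vertex_set_def cube_def nth_append)
    finally show ?thesis .
  qed
  ultimately show ?thesis unfolding implements_def by blast
qed

section \<open>Translation between circuit records and \<open>terminal_graph\<close>\<close>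

lemma vertices_eq: "vertices C = vertex_set (arity C) (inner C)"
  by (simp add: vertices_def vertex_set_def)

lemma terminal_eqI:
  assumes "{e \<in> edges C. Ext i \<in> e} = {t}"
  shows "terminal C i = t"
proof -
  have "e \<in> edges C \<and> Ext i \<in> e \<longleftrightarrow> e = t" for e using assms by blast
  then show ?thesis by (simp add: terminal_def)
qed

lemma circuit_graph_imp_terminal_graph:
  assumes C: "circuit_graph C" and W: "\<forall>e\<in>edges C - terminals C. weight C e \<in> W" "1 \<in> W"
  shows "terminal_graph W (arity C) (inner C) (edges C) (weight C)"
proof -
  have E: "\<And>e. e \<in> edges C \<Longrightarrow> e \<subseteq> vertices C" "\<And>e. e \<in> edges C \<Longrightarrow> card e = 2"
    using C by (auto simp: circuit_graph_def)
  have leaf: "{e \<in> edges C. Ext i \<in> e} = {terminal C i}" if "i < arity C" for i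
  proof -
    have "card {e \<in> edges C. Ext i \<in> e} = 1"
      using C that by (simp add: circuit_graph_def degree_def)
    then obtain t where t: "{e \<in> edges C. Ext i \<in> e} = {t}" by (rule card_1_singletonE)
    then show ?thesis by (simp add: terminal_eqI)
  qed
  have wt: "weight C (terminal C i) = 1" if "i < arity C" for i
    using C that by (simp add: circuit_graph_def terminals_def)
  have ex: "\<exists>j. terminal C i = {Ext i, Inn j}" if i: "i < arity C" for i
  proof -
    have t: "terminal C i \<in> edges C" "Ext i \<in> terminal C i" using leaf[OF i] by auto
    obtain v where v: "terminal C i = {Ext i, v}" "v \<noteq> Ext i"
      using E(2)[OF t(1)] t(2) unfolding card_2_iff by (metis doubleton_eq_iff insertE singletonD)
    show ?thesis
    proof (cases v)
      \<comment> \<open>An edge between \<open>Ext i\<close> and \<open>Ext j\<close> would be the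
        terminal of both, against injectivity.\<close>
      case (Ext j)
      then have j: "j < arity C" "j \<noteq> i"
        using E(1)[OF t(1)] v by (auto simp: vertices_def)
      have "terminal C i \<in> {e \<in> edges C. Ext j \<in> e}" using t v Ext by simp
      then have "terminal C i = terminal C j" using leaf[OF j(1)] by simp
      then have "i = j" using C i j(1) by (auto simp: circuit_graph_def inj_on_def)
      then show ?thesis using j by simp
    next
      case (Inn j)
      then show ?thesis using v by auto
    qed
  qed
  show ?thesis
    unfolding terminal_graph_def
  proof (intro conjI allI impI ballI)
    show "arity C \<le> inner C" using C by (simp add: circuit_graph_def)
    show "edges C \<subseteq> {e. e \<subseteq> vertex_set (arity C) (inner C) \<and> card e = 2}"
      using E by (auto simp: vertices_eq)
    show "\<exists>j. {e \<in> edges C. Ext i \<in> e} = {{Ext i, Inn j}}" if "i < arity C" for i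
      using leaf[OF that] ex[OF that] by auto
    show "weight C e \<in> W" if "e \<in> edges C" for e
    proof (cases "e \<in> terminals C")
      case True
      then show ?thesis using wt W(2) by (auto simp: terminals_def)
    next
      case False
      then show ?thesis using that W(1) by auto
    qed
    show "weight C e = 1" if "i < arity C" "e \<in> edges C" "Ext i \<in> e" for i e
    proof -
      have "e \<in> {e \<in> edges C. Ext i \<in> e}" using that by simp
      then show ?thesis using leaf[OF that(1)] wt[OF that(1)] by simp
    qed
  qed
qed

lemma terminal_graph_imp_circuit_graph:
  assumes G: "terminal_graph W (arity C) (inner C) (edges C) (weight C)"
  shows "circuit_graph C \<and> (\<forall>e\<in>edges C - terminals C. weight C e \<in> W)"
  unfolding circuit_graph_def
proof (intro conjI allI impI ballI)
  have leaf: "\<exists>j. {e \<in> edges C. Ext i \<in> e} = {{Ext i, Inn j}} \<and> terminal C i = {Ext i, Inn j}"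
    if "i < arity C" for i
    using terminal_graph_leaf[OF G that] terminal_eqI by metis
  show "arity C \<le> inner C" by (rule terminal_graphD(4)[OF G])
  show "edges C \<subseteq> {e. e \<subseteq> vertices C \<and> card e = 2}"
    using terminal_graphD(2,6)[OF G] by (auto simp: vertices_eq)
  show "degree (edges C) (Ext i) = 1" if i: "i < arity C" for i
  proof -
    obtain j where j: "{e \<in> edges C. Ext i \<in> e} = {{Ext i, Inn j}}" using leaf[OF i] by blast
    show ?thesis unfolding degree_def j by simp
  qed
  show "inj_on (terminal C) {..<arity C}"
  proof (rule inj_onI)
    fix i i' assume "i \<in> {..<arity C}" "i' \<in> {..<arity C}" and eq: "terminal C i = terminal C i'"
    then have i: "i < arity C" "i' < arity C" by simp_all
    obtain j where t: "terminal C i = {Ext i, Inn j}" using leaf[OF i(1)] by blast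
    obtain j' where t': "terminal C i' = {Ext i', Inn j'}" using leaf[OF i(2)] by blast
    have "{Ext i, Inn j} = {Ext i', Inn j'}" unfolding t[symmetric] t'[symmetric] by (rule eq)
    then show "i = i'" by (simp add: doubleton_eq_iff)
  qed
  show "weight C e = 1" if e: "e \<in> terminals C" for e
  proof -
    obtain i where i: "i < arity C" "e = terminal C i" using e by (auto simp: terminals_def)
    obtain j where j: "{e \<in> edges C. Ext i \<in> e} = {{Ext i, Inn j}}" "e = {Ext i, Inn j}"
      using leaf[OF i(1)] i(2) by blast
    then have "e \<in> edges C" "Ext i \<in> e" by auto
    then show ?thesis using terminal_graphD(7)[OF G i(1)] by simp
  qed
  show "weight C e \<in> W" if "e \<in> edges C - terminals C" for e
    using that terminal_graphD(5)[OF G] by auto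
qed

text \<open>The single edge at \<open>Ext i\<close> is its terminal, so the degree of
  \<open>H\<close> there is 1 or 0 according to whether \<open>H\<close> contains the
  terminal.\<close>

lemma circuit_sum_eq_holant:
  assumes G: "terminal_graph W (arity C) (inner C) (edges C) (weight C)"
  shows "(\<Sum>H | H \<subseteq> edges C \<and> agrees_on_terminals C ys H \<and> (\<forall>j<inner C. P (degree H (Inn j))).
      \<Prod>e\<in>H. weight C e)
    = holant (vertex_set (arity C) (inner C)) (edges C) (weight C) (constraint P ys)"
proof -
  have *: "(terminal C i \<in> H \<longleftrightarrow> ys ! i) \<longleftrightarrow> degree H (Ext i) = of_bool (ys ! i)"
    if i: "i < arity C" and H: "H \<subseteq> edges C" for i H
  proof -
    obtain j where j: "{e \<in> edges C. Ext i \<in> e} = {{Ext i, Inn j}}"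
      using terminal_graph_leaf[OF G i] .
    then have t: "terminal C i = {Ext i, Inn j}" by (rule terminal_eqI)
    have "{e \<in> H. Ext i \<in> e} = H \<inter> {e \<in> edges C. Ext i \<in> e}" using H by auto
    then have "degree H (Ext i) = of_bool (terminal C i \<in> H)"
      unfolding degree_def j t by (simp add: of_bool_def)
    then show ?thesis by auto
  qed
  have "agrees_on_terminals C ys H \<and> (\<forall>j<inner C. P (degree H (Inn j))) \<longleftrightarrow>
      (\<forall>v\<in>vertex_set (arity C) (inner C). constraint P ys v (degree H v))"
    if "H \<subseteq> edges C" for H
  proof -
    have "agrees_on_terminals C ys H \<longleftrightarrow> (\<forall>i<arity C. degree H (Ext i) = of_bool (ys ! i))"
      using *[OF _ that] by (simp add: agrees_on_terminals_def)
    then show ?thesis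
      by (simp only: vertex_set_def ball_Un ball_simps constraint_simps)
        (simp only: Ball_def lessThan_iff)
  qed
  then have "{H. H \<subseteq> edges C \<and> agrees_on_terminals C ys H \<and> (\<forall>j<inner C. P (degree H (Inn j)))}
    = {H \<in> Pow (edges C). \<forall>v\<in>vertex_set (arity C) (inner C). constraint P ys v (degree H v)}"
    by auto
  then show ?thesis
    using terminal_graphD(1)[OF G]
    by (simp add: holant_def sum.inter_filter flip: of_bool_def) (auto intro!: sum.cong)
qed

text \<open>\<open>fourier k f\<close> is extensional on the cube, so agreement on the cube is the
  equality of functions that the class definitions demand.\<close>

lemma implements_iff_circuit:
  assumes "1 \<in> W"
  shows "implements P W k (fourier k f) \<longleftrightarrow>
    (\<exists>C. circuit_graph C \<and> (\<forall>e\<in>edges C - terminals C. weight C e \<in> W) \<and> arity C = k \<and>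
      (\<lambda>ys\<in>cube (arity C). \<Sum>H | H \<subseteq> edges C \<and> agrees_on_terminals C ys H \<and>
        (\<forall>j<inner C. P (degree H (Inn j))). \<Prod>e\<in>H. weight C e) = fourier k f)"
    (is "_ \<longleftrightarrow> ?R")
proof
  assume "implements P W k (fourier k f)"
  then obtain n E w where G: "terminal_graph W k n E w"
    and F: "\<And>y. y \<in> cube k \<Longrightarrow> fourier k f y = holant (vertex_set k n) E w (constraint P y)"
    by (auto simp: implements_def)
  define C where "C = \<lparr>arity = k, inner = n, edges = E, weight = w\<rparr>"
  have G': "terminal_graph W (arity C) (inner C) (edges C) (weight C)"
    using G by (simp add: C_def)
  have "(\<lambda>ys\<in>cube (arity C). \<Sum>H | H \<subseteq> edges C \<and> agrees_on_terminals C ys H \<and>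
        (\<forall>j<inner C. P (degree H (Inn j))). \<Prod>e\<in>H. weight C e) = fourier k f"
    unfolding circuit_sum_eq_holant[OF G']
    by (rule ext) (simp add: C_def F fourier_def[of k f] restrict_def flip: F)
  then show ?R using terminal_graph_imp_circuit_graph[OF G'] by (intro exI[of _ C]) (simp add: C_def)
next
  assume ?R
  then obtain C where C: "circuit_graph C" "\<forall>e\<in>edges C - terminals C. weight C e \<in> W" "arity C = k"
    and F: "(\<lambda>ys\<in>cube (arity C). \<Sum>H | H \<subseteq> edges C \<and> agrees_on_terminals C ys H \<and>
        (\<forall>j<inner C. P (degree H (Inn j))). \<Prod>e\<in>H. weight C e) = fourier k f"
    by blast
  note G = circuit_graph_imp_terminal_graph[OF C(1,2) assms]
  have "fourier k f y = holant (vertex_set k (inner C)) (edges C) (weight C) (constraint P y)"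
    if "y \<in> cube k" for y
    using that unfolding F[symmetric] circuit_sum_eq_holant[OF G] by (simp add: C(3))
  then show "implements P W k (fourier k f)"
    using G unfolding implements_def C(3) by blast
qed

section \<open>Elementary circuits\<close>

text \<open>The isolated edge lies in every perfect matching. Under the condition
  \<open>even\<close> it would lie in no admissible set, so this serves matchings only.\<close>

lemma implements_const:
  assumes "c \<in> W"
  shows "implements (\<lambda>d. d = 1) W 0 (\<lambda>_. c)"
  unfolding implements_def
proof (intro exI conjI ballI)
  have V: "vertex_set 0 2 = {Inn 0, Inn 1}"
    by (auto simp: vertex_set_def lessThan_Suc numeral_2_eq_2)
  show "terminal_graph W 0 2 {{Inn 0, Inn 1}} (\<lambda>_. c)"
    using assms by (simp add: terminal_graph_def V)
  show "c = holant (vertex_set 0 2) {{Inn 0, Inn 1}} (\<lambda>_. c) (constraint (\<lambda>d. d = 1) y)" for y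
    by (simp add: V holant_def sum_Pow_insert degree_insert del: sum_of_bool_mult_eq sum_mult_of_bool_eq sum_of_bool_eq)
qed

text \<open>The two conditions are listed outright because each gadget is verified by enumeration in
  either case.\<close>

locale matching_or_even =
  fixes P :: "nat \<Rightarrow> bool" and W :: "real set"
  assumes P: "P = (\<lambda>d. d = 1) \<or> P = even" and one_in_W: "1 \<in> W"
begin

text \<open>\<open>Inn 1\<close> is a dead end. A matching must cover it by the edge to
  \<open>Inn 0\<close>, which blocks the terminal; an even set must avoid that edge and hence the
  terminal.\<close>

lemma implements_not: "implements P W 1 (\<lambda>y. of_bool (\<not> y ! 0))"
  unfolding implements_def
proof (intro exI conjI ballI)
  let ?E = "{{Ext 0, Inn 0}, {Inn 0, Inn 1}}"
  have V: "vertex_set (Suc 0) 2 = {Ext 0, Inn 0, Inn 1}"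
    by (auto simp: vertex_set_def lessThan_Suc numeral_2_eq_2)
  have "{e \<in> ?E. Ext 0 \<in> e} = {{Ext 0, Inn 0}}" by auto
  then show "terminal_graph W 1 2 ?E (\<lambda>_. 1)"
    unfolding terminal_graph_def One_nat_def V using one_in_W by (simp only: less_one flip: One_nat_def) auto
  show "of_bool (\<not> y ! 0) = holant (vertex_set 1 2) ?E (\<lambda>_. 1) (constraint P y)" for y
    using P by (auto simp: V holant_def sum_Pow_insert degree_insert doubleton_eq_iff
          simp del: sum_of_bool_mult_eq sum_mult_of_bool_eq sum_of_bool_eq)
qed

text \<open>A path of three edges. A matching alternates along it, and the odd length makes both
  ends agree; an even set contains all of the path or nothing.\<close>

lemma implements_eq: "implements P W 2 (\<lambda>y. of_bool (y ! 0 = y ! 1))"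
  unfolding implements_def
proof (intro exI conjI ballI)
  let ?E = "{{Ext 0, Inn 0}, {Inn 0, Inn 1}, {Ext 1, Inn 1}}"
  have V: "vertex_set 2 2 = {Ext 0, Ext 1, Inn 0, Inn 1}"
    by (auto simp: vertex_set_def lessThan_Suc numeral_2_eq_2)
  have "{e \<in> ?E. Ext 0 \<in> e} = {{Ext 0, Inn 0}}" "{e \<in> ?E. Ext (Suc 0) \<in> e} = {{Ext 1, Inn 1}}" by auto
  then show "terminal_graph W 2 2 ?E (\<lambda>_. 1)"
    using one_in_W by (auto simp: terminal_graph_def V less_2_cases_iff)
  show "of_bool (y ! 0 = y ! 1) = holant (vertex_set 2 2) ?E (\<lambda>_. 1) (constraint P y)" for y
    using P by (auto simp: V holant_def sum_Pow_insert degree_insert doubleton_eq_iff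
          simp del: sum_of_bool_mult_eq sum_mult_of_bool_eq sum_of_bool_eq)
qed

end

section \<open>Identification of two arguments\<close>

text \<open>
  The triangle \<open>p q r\<close> lets a matching through iff an odd number of its corners is matched from outside;
  the vertex \<open>m\<close>, which subdivides the edge from \<open>r\<close> to the new terminal \<open>x\<close>, makes this an even number.
  In \<open>R d d'\<close> the numbers \<open>d\<close> and \<open>d'\<close> are the degrees that the gadget contributes at \<open>p\<close> and \<open>q\<close>.
\<close>

lemma gadget_sum:
  fixes p q r m x :: vertex and R :: "nat \<Rightarrow> nat \<Rightarrow> real"
  assumes "distinct [p, q, r, m, x]"
  defines "G \<equiv> {{p, q}, {p, r}, {q, r}, {r, m}, {m, x}}"
  shows
    "(\<Sum>X\<in>Pow G. of_bool (degree X r = 1 \<and> degree X m = 1 \<and> degree X x = of_bool z) *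
        R (degree X p) (degree X q))
      = (if z then R 1 0 + R 0 1 + R (Suc (Suc 0)) 1 + R 1 (Suc (Suc 0)) else R 0 0 + R 1 1)"
    "(\<Sum>X\<in>Pow G. of_bool (even (degree X r) \<and> even (degree X m) \<and> degree X x = of_bool z) *
        R (degree X p) (degree X q))
      = (if z then R 1 0 + R 0 1 + R (Suc (Suc 0)) 1 + R 1 (Suc (Suc 0)) else R 0 0 + R 1 1 + R 1 1 + R (Suc (Suc 0)) (Suc (Suc 0)))"
proof -
  have "p \<noteq> q" "p \<noteq> r" "p \<noteq> m" "p \<noteq> x" "q \<noteq> r" "q \<noteq> m" "q \<noteq> x" "r \<noteq> m" "r \<noteq> x" "m \<noteq> x"
    using assms(1) by auto
  note neq = this this[symmetric]
  note sums = sum_Pow_insert degree_insert doubleton_eq_iff neq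
  \<comment> \<open>If \<open>z\<close>, then \<open>{m, x}\<close> is chosen, \<open>{r, m}\<close>
    is not, and exactly one of \<open>{p, r}\<close>, \<open>{q, r}\<close> is. Otherwise
    \<open>{r, m}\<close> is chosen and these two are not. The edge \<open>{p, q}\<close> is free in
    both cases.\<close>
  show "(\<Sum>X\<in>Pow G. of_bool (degree X r = 1 \<and> degree X m = 1 \<and> degree X x = of_bool z) *
        R (degree X p) (degree X q))
      = (if z then R 1 0 + R 0 1 + R (Suc (Suc 0)) 1 + R 1 (Suc (Suc 0)) else R 0 0 + R 1 1)"
    unfolding G_def
    by (simp add: sums del: sum_of_bool_mult_eq sum_mult_of_bool_eq sum_of_bool_eq)
  \<comment> \<open>Now \<open>{r, m}\<close> and \<open>{m, x}\<close> are chosen together, exactly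
    if \<open>z\<close>. Then one of \<open>{p, r}\<close>, \<open>{q, r}\<close> is chosen;
    otherwise both or neither. Again \<open>{p, q}\<close> is free.\<close>
  show "(\<Sum>X\<in>Pow G. of_bool (even (degree X r) \<and> even (degree X m) \<and> degree X x = of_bool z) *
        R (degree X p) (degree X q))
      = (if z then R 1 0 + R 0 1 + R (Suc (Suc 0)) 1 + R 1 (Suc (Suc 0)) else R 0 0 + R 1 1 + R 1 1 + R (Suc (Suc 0)) (Suc (Suc 0)))"
    unfolding G_def
    by (simp add: sums del: sum_of_bool_mult_eq sum_mult_of_bool_eq sum_of_bool_eq)
qed

text \<open>The external vertices \<open>i\<close> and \<open>k\<close> turn into the inner corners
  \<open>p\<close> and \<open>q\<close>, so their terminals become ordinary edges of weight 1, and
  the gadget supplies a new leaf \<open>Ext i\<close>. It admits exactly those pairs of values on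
  the old terminals whose sum mod 2 is \<open>y ! i\<close>.\<close>

lemma (in matching_or_even) implements_merge:
  assumes "implements P W (Suc k) F" "i < k"
  obtains c where "c > 0"
    "implements P W k (\<lambda>y. c * (\<Sum>b\<in>{False, True}. F (y[i := (y ! i \<noteq> b)] @ [b])))"
proof -
  obtain n E w where C: "terminal_graph W (Suc k) n E w"
    and F: "\<And>y. y \<in> cube (Suc k) \<Longrightarrow> F y = holant (vertex_set (Suc k) n) E w (constraint P y)"
    using assms(1) by (auto simp: implements_def)
  define p q r m where "p = Inn n" and "q = Inn (n + 1)" and "r = Inn (n + 2)" and "m = Inn (n + 3)"
  note new_vertices = p_def q_def r_def m_def
  \<comment> \<open>Swapping \<open>Ext i\<close> with \<open>p\<close> and \<open>Ext k\<close>
    with \<open>q\<close>, instead of only renaming one way, keeps \<open>\<rho>\<close> injective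
    on the whole type.\<close>
  define \<rho> where "\<rho> v = (if v = Ext i then p else if v = Ext k then q
    else if v = p then Ext i else if v = q then Ext k else v)" for v
  have \<rho>_p: "\<rho> (Ext i) = p" and \<rho>_q: "\<rho> (Ext k) = q"
    using assms(2) by (auto simp: \<rho>_def)
  have \<rho>_Ext: "\<rho> (Ext l) = Ext l" if "l < k" "l \<noteq> i" for l
    using that by (auto simp: \<rho>_def new_vertices)
  have \<rho>_Inn: "\<rho> (Inn j) = Inn j" if "j < n" for j
    using that by (auto simp: \<rho>_def new_vertices)
  have inj: "inj \<rho>"
    using assms(2) by (intro injI) (auto simp: \<rho>_def new_vertices split: if_splits)
  define V\<^sub>1 E\<^sub>1 where "V\<^sub>1 = \<rho> ` vertex_set (Suc k) n" and "E\<^sub>1 = (`) \<rho> ` E"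
  define G where "G = {{p, q}, {p, r}, {q, r}, {r, m}, {m, Ext i}}"
  define u where "u e = (if e \<in> E\<^sub>1 then w (\<rho> -` e) else 1)" for e
  have V\<^sub>1: "V\<^sub>1 = Ext ` ({..<k} - {i}) \<union> Inn ` {..<n + 2}"
  proof -
    have V: "vertex_set (Suc k) n = {Ext i, Ext k} \<union> Ext ` ({..<k} - {i}) \<union> Inn ` {..<n}"
      using assms(2) by (auto simp: vertex_set_def)
    have Ext: "\<rho> ` Ext ` ({..<k} - {i}) = Ext ` ({..<k} - {i})"
      unfolding image_image by (rule image_cong) (simp_all add: \<rho>_Ext)
    have Inn: "\<rho> ` Inn ` {..<n} = Inn ` {..<n}"
      unfolding image_image by (rule image_cong) (simp_all add: \<rho>_Inn)
    have n2: "{..<n + 2} = {n, n + 1} \<union> {..<n}" by auto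
    have "Inn ` {..<n + 2} = {p, q} \<union> Inn ` {..<n}"
      unfolding n2 new_vertices by (simp only: image_Un image_insert image_empty)
    then show ?thesis
      unfolding V\<^sub>1_def V image_Un Ext Inn image_insert image_empty \<rho>_p \<rho>_q
      by (simp only: Un_ac)
  qed
  have V: "vertex_set k (n + 4) = insert r (insert m (insert (Ext i) V\<^sub>1))"
  proof -
    have "{..<n + 4} = {n + 2, n + 3} \<union> {..<n + 2}" by auto
    moreover have "{..<k} = insert i ({..<k} - {i})" using assms(2) by auto
    ultimately show ?thesis
      unfolding vertex_set_def V\<^sub>1 r_def m_def by blast
  qed
  have notin: "r \<notin> V\<^sub>1" "m \<notin> V\<^sub>1" "Ext i \<notin> V\<^sub>1"
    by (auto simp: V\<^sub>1 new_vertices)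
  have E\<^sub>1: "finite E\<^sub>1" "E\<^sub>1 \<subseteq> Pow V\<^sub>1" "\<And>e. e \<in> E\<^sub>1 \<Longrightarrow> card e = 2"
    using terminal_graphD[OF C] by (auto simp: E\<^sub>1_def V\<^sub>1_def card_image inj_on_subset[OF inj])
  have notin_e: "r \<notin> e" "m \<notin> e" "Ext i \<notin> e" if "e \<in> E\<^sub>1" for e
    using that E\<^sub>1(2) notin by auto
  obtain j\<^sub>i where j\<^sub>i: "{e \<in> E. Ext i \<in> e} = {{Ext i, Inn j\<^sub>i}}"
    using terminal_graph_leaf[OF C, of i] assms(2) by auto
  obtain j\<^sub>k where j\<^sub>k: "{e \<in> E. Ext k \<in> e} = {{Ext k, Inn j\<^sub>k}}"
    using terminal_graph_leaf[OF C, of k] by auto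
  \<comment> \<open>The other gadget edges contain \<open>r\<close>, \<open>m\<close> or the new
    \<open>Ext i\<close>. Only \<open>{p, q}\<close> could coincide with an old edge, which would
    then have joined two external vertices.\<close>
  have pq: "{p, q} \<notin> E\<^sub>1"
  proof
    assume "{p, q} \<in> E\<^sub>1"
    then obtain e where e: "e \<in> E" "\<rho> ` e = \<rho> ` {Ext i, Ext k}"
      by (auto simp: E\<^sub>1_def \<rho>_p \<rho>_q)
    then have "e = {Ext i, Ext k}" by (simp only: inj_image_eq_iff[OF inj])
    with e(1) have "{Ext i, Ext k} \<in> {e \<in> E. Ext i \<in> e}" by simp
    then show False unfolding j\<^sub>i using assms(2) by (auto simp: doubleton_eq_iff)
  qed
  have disj: "E\<^sub>1 \<inter> G = {}"
    using pq notin_e by (auto simp: G_def)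
  have u1: "u (\<rho> ` e) = w e" if "e \<in> E" for e
    using that by (simp add: u_def E\<^sub>1_def inj_vimage_image_eq[OF inj])
  have uG: "u e = 1" if "e \<in> G" for e
    using that disj by (auto simp: u_def)
  have graph: "terminal_graph W k (n + 4) (E\<^sub>1 \<union> G) u"
    unfolding terminal_graph_def
  proof (intro conjI allI impI ballI)
    show "k \<le> n + 4" using terminal_graphD(4)[OF C] by simp
    have "G \<subseteq> {e. e \<subseteq> vertex_set k (n + 4) \<and> card e = 2}"
      using assms(2) by (auto simp: G_def vertex_set_def new_vertices)
    moreover have "E\<^sub>1 \<subseteq> {e. e \<subseteq> vertex_set k (n + 4) \<and> card e = 2}"
      using E\<^sub>1(2,3) unfolding V by auto
    ultimately show "E\<^sub>1 \<union> G \<subseteq> {e. e \<subseteq> vertex_set k (n + 4) \<and> card e = 2}" by simp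
    show "u e \<in> W" if "e \<in> E\<^sub>1 \<union> G" for e
      using that u1 uG terminal_graphD(5)[OF C] one_in_W by (auto simp: E\<^sub>1_def)
    fix l assume l: "l < k"
    have leaf: "\<exists>j. {e \<in> E\<^sub>1 \<union> G. Ext l \<in> e} = {{Ext l, Inn j}} \<and> u {Ext l, Inn j} = 1"
    proof (cases "l = i")
      case True
      have "{e \<in> G. Ext i \<in> e} = {{Ext i, m}}"
        by (auto simp: G_def new_vertices)
      then have "{e \<in> E\<^sub>1 \<union> G. Ext i \<in> e} = {{Ext i, m}}" using notin_e(3) by blast
      moreover have "u {Ext i, m} = 1"
        by (rule uG) (auto simp: G_def)
      ultimately show ?thesis unfolding True m_def by blast
    next
      case False
      obtain j where j: "j < n" "{e \<in> E. Ext l \<in> e} = {{Ext l, Inn j}}"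
        using terminal_graph_leaf[OF C, of l] l by auto
      have "Ext l \<notin> e" if "e \<in> G" for e
        using that False by (auto simp: G_def new_vertices)
      then have "{e \<in> E\<^sub>1 \<union> G. Ext l \<in> e} = {e \<in> E\<^sub>1. \<rho> (Ext l) \<in> e}"
        using \<rho>_Ext[OF l False] by auto
      also have "\<dots> = (`) \<rho> ` {e \<in> E. Ext l \<in> e}"
        unfolding E\<^sub>1_def using inj_image_mem_iff[OF inj] by blast
      also have "\<dots> = {\<rho> ` {Ext l, Inn j}}" by (simp only: j(2) image_insert image_empty)
      finally have eq: "{e \<in> E\<^sub>1 \<union> G. Ext l \<in> e} = {\<rho> ` {Ext l, Inn j}}" .
      have t: "{Ext l, Inn j} \<in> E" using j(2) by auto
      have "u (\<rho> ` {Ext l, Inn j}) = 1"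
        unfolding u1[OF t] by (rule terminal_graphD(7)[OF C _ t, of l]) (use l in auto)
      moreover have "\<rho> ` {Ext l, Inn j} = {Ext l, Inn j}"
        using \<rho>_Ext[OF l False] \<rho>_Inn[OF j(1)] by simp
      ultimately show ?thesis using eq by auto
    qed
    then show "\<exists>j. {e \<in> E\<^sub>1 \<union> G. Ext l \<in> e} = {{Ext l, Inn j}}" by blast
    show "u e = 1" if e: "e \<in> E\<^sub>1 \<union> G" "Ext l \<in> e" for e
    proof -
      obtain j where j: "{e \<in> E\<^sub>1 \<union> G. Ext l \<in> e} = {{Ext l, Inn j}}" "u {Ext l, Inn j} = 1"
        using leaf by blast
      have "e \<in> {e \<in> E\<^sub>1 \<union> G. Ext l \<in> e}" using e by blast
      then have "e = {Ext l, Inn j}" unfolding j(1) by (rule singletonD)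
      then show ?thesis by (simp only: j(2))
    qed
  qed
  \<comment> \<open>Adding the whole triangle mod 2 preserves the parity of every degree, so even
    sets come in pairs.\<close>
  define c :: real where "c = (if P = even then 2 else 1)"
  have val: "holant (vertex_set k (n + 4)) (E\<^sub>1 \<union> G) u (constraint P y)
      = c * (\<Sum>b\<in>{False, True}. F (y[i := (y ! i \<noteq> b)] @ [b]))" if y: "y \<in> cube k" for y
  proof -
    \<comment> \<open>\<open>Z\<close> is the old circuit with free constraints at the two corners,
      \<open>S\<close> its value for prescribed bits, and \<open>R\<close> its value once the gadget
      has contributed degrees \<open>d\<close> and \<open>d'\<close> there.\<close>
    define Z where "Z A B = holant V\<^sub>1 E\<^sub>1 u ((constraint P y)(p := A, q := B))" for A B
    define S where "S a b = F (y[i := a] @ [b])" for a b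
    define R where "R d d' = Z (\<lambda>x. P (x + d)) (\<lambda>x. P (x + d'))" for d d'
    have deg_leaf: "degree E\<^sub>1 p = 1" "degree E\<^sub>1 q = 1"
      using degree_image[OF inj, of E "Ext i"] degree_image[OF inj, of E "Ext k"]
      unfolding degree_def[of E] j\<^sub>i j\<^sub>k by (simp_all add: E\<^sub>1_def \<rho>_p \<rho>_q)
    have Z_cong: "Z A B = Z A' B'"
      if "\<And>d. d \<le> 1 \<Longrightarrow> A d = A' d" "\<And>d. d \<le> 1 \<Longrightarrow> B d = B' d" for A B A' B'
      unfolding Z_def using that deg_leaf E\<^sub>1(1) by (intro holant_cong) (auto simp: fun_upd_def)
    have Z_eq: "Z (\<lambda>d. d = of_bool a) (\<lambda>d. d = of_bool b) = S a b" for a b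
    proof -
      have mem: "y[i := a] @ [b] \<in> cube (Suc k)" using y by (simp add: cube_def)
      have "Z (\<lambda>d. d = of_bool a) (\<lambda>d. d = of_bool b)
        = holant V\<^sub>1 E\<^sub>1 (\<lambda>e. w (\<rho> -` e)) ((constraint P y)(p := \<lambda>d. d = of_bool a, q := \<lambda>d. d = of_bool b))"
        unfolding Z_def using E\<^sub>1(1) by (intro holant_cong) (auto simp: u_def)
      also have "\<dots> = holant (vertex_set (Suc k) n) E w
          (\<lambda>v. ((constraint P y)(p := \<lambda>d. d = of_bool a, q := \<lambda>d. d = of_bool b)) (\<rho> v))"
        unfolding V\<^sub>1_def E\<^sub>1_def by (rule holant_relabel[OF inj])
      also have "\<dots> = S a b"
        unfolding S_def F[OF mem]
      proof (rule holant_cong)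
        show "finite E" by (rule terminal_graphD(1)[OF C])
        fix v d assume "v \<in> vertex_set (Suc k) n"
        then consider "v = Ext i" | "v = Ext k" | l where "v = Ext l" "l < k" "l \<noteq> i"
          | j where "v = Inn j" "j < n"
          by (auto simp: vertex_set_def less_Suc_eq) blast
        then show "((constraint P y)(p := \<lambda>d. d = of_bool a, q := \<lambda>d. d = of_bool b)) (\<rho> v) d
          \<longleftrightarrow> constraint P (y[i := a] @ [b]) v d"
          using y assms(2)
          by cases (simp_all add: \<rho>_p \<rho>_q \<rho>_Ext \<rho>_Inn cube_def nth_append, simp_all add: new_vertices)
      qed simp
      finally show ?thesis .
    qed
    have "holant (vertex_set k (n + 4)) (E\<^sub>1 \<union> G) u (constraint P y)
      = (\<Sum>X\<in>Pow G. prod u X *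
          holant (vertex_set k (n + 4)) E\<^sub>1 u (\<lambda>v d. constraint P y v (d + degree X v)))"
      using E\<^sub>1(1) disj by (intro holant_add_edges) (auto simp: G_def)
    also have "\<dots> = (\<Sum>X\<in>Pow G. of_bool (P (degree X r) \<and> P (degree X m) \<and>
        degree X (Ext i) = of_bool (y ! i)) * R (degree X p) (degree X q))"
    proof (rule sum.cong[OF refl])
      fix X assume X: "X \<in> Pow G"
      have "prod u X = 1" using X uG by (intro prod.neutral) auto
      moreover have "degree X v = 0" if "v \<in> V\<^sub>1" "v \<noteq> p" "v \<noteq> q" for v
        using X that notin by (intro degree_eq_0) (auto simp: G_def)
      then have "holant V\<^sub>1 E\<^sub>1 u (\<lambda>v d. constraint P y v (d + degree X v)) = R (degree X p) (degree X q)"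
        unfolding R_def Z_def using E\<^sub>1(1) by (intro holant_cong) (auto simp: p_def q_def)
      ultimately show "prod u X *
          holant (vertex_set k (n + 4)) E\<^sub>1 u (\<lambda>v d. constraint P y v (d + degree X v)) =
          of_bool (P (degree X r) \<and> P (degree X m) \<and>
        degree X (Ext i) = of_bool (y ! i)) * R (degree X p) (degree X q)"
        unfolding V using notin_e by (simp add: holant_isolated) (simp add: r_def m_def)
    qed
    also have "\<dots> = c * (\<Sum>b\<in>{False, True}. S (y ! i \<noteq> b) b)"
    proof -
      have dist: "distinct [p, q, r, m, Ext i]" by (simp add: new_vertices)
      note sums = gadget_sum[OF dist, of "y ! i" R, folded G_def]
      show ?thesis
      proof (cases "P = even")
        case True
        \<comment> \<open>The old circuit contributes degree at most 1 at each corner, so this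
          degree is determined by the parity of the gadget's share.\<close>
        have R: "R d d' = S (odd d) (odd d')" for d d'
          unfolding R_def Z_eq[symmetric] True by (rule Z_cong) (auto simp: le_Suc_eq)
        show ?thesis using sums(2) by (simp add: c_def True R)
      next
        case False
        then have P: "P = (\<lambda>d. d = 1)" using P by auto
        \<comment> \<open>A corner is matched exactly once, so the old terminal takes the value
          complementary to the gadget's degree.\<close>
        have R: "R (of_bool (\<not> a)) (of_bool (\<not> b)) = S a b" for a b
          unfolding R_def Z_eq[symmetric] P by (rule Z_cong) (auto simp: le_Suc_eq)
        \<comment> \<open>Two gadget edges at one corner already violate the matching
          condition.\<close>
        have R0: "R (Suc (Suc 0)) 1 = 0" "R 1 (Suc (Suc 0)) = 0"
          unfolding R_def Z_def P
          by (rule holant_eq_0[of p] holant_eq_0[of q]; simp add: V\<^sub>1 p_def q_def)+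
        show ?thesis
          using sums(1) R[of False False] R[of False True] R[of True False] R[of True True] False R0
          by (simp add: c_def P)
      qed
    qed
    finally show ?thesis by (simp only: S_def)
  qed
  show thesis
  proof (rule that)
    show "c > 0" by (simp add: c_def)
    show "implements P W k (\<lambda>y. c * (\<Sum>b\<in>{False, True}. F (y[i := (y ! i \<noteq> b)] @ [b])))"
      unfolding implements_def using graph val by metis
  qed
qed

section \<open>The two clones\<close>

lemma implements_cong:
  assumes "implements P W k F" "\<And>y. y \<in> cube k \<Longrightarrow> F y = G y"
  shows "implements P W k G"
  using assms unfolding implements_def by (metis (no_types, lifting))

section \<open>Realizability up to a positive constant\<close>

context matching_or_even
begin

text \<open>The free constant absorbs the 1/2 of \<open>EQ\<close>, the 2 of a summation and the
  factor of \<open>implements_merge\<close>. No sign condition on \<open>f\<close> is included; it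
  is imposed in \<open>scaled_class\<close>.\<close>

definition realizable :: "nat \<Rightarrow> bfun \<Rightarrow> bool" where
  "realizable k f \<longleftrightarrow>
    (\<exists>c F. c > 0 \<and> implements P W k F \<and> (\<forall>x\<in>cube k. fourier k f x = c * F x))"

lemma realizable_cong:
  assumes "\<And>x. x \<in> cube k \<Longrightarrow> f x = g x"
  shows "realizable k f \<longleftrightarrow> realizable k g"
proof -
  have "fourier k f = fourier k g" using assms by (rule fourier_cong)
  then show ?thesis by (simp add: realizable_def)
qed

lemma realizable_EQ: "realizable 2 EQ"
  unfolding realizable_def
  by (intro exI[of _ "1/2"] exI[of _ "\<lambda>y. of_bool (y ! 0 = y ! 1)"])
    (simp add: implements_eq fourier_EQ del: One_nat_def)

lemma realizable_tensor:
  assumes "realizable k f" "realizable l g"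
  shows "realizable (k + l) (\<lambda>x. f (take k x) * g (drop k x))"
proof -
  obtain c F where f: "c > 0" "implements P W k F" "\<And>x. x \<in> cube k \<Longrightarrow> fourier k f x = c * F x"
    using assms(1) by (auto simp: realizable_def)
  obtain d G where g: "d > 0" "implements P W l G" "\<And>x. x \<in> cube l \<Longrightarrow> fourier l g x = d * G x"
    using assms(2) by (auto simp: realizable_def)
  have "take k x \<in> cube k" "drop k x \<in> cube l" if "x \<in> cube (k + l)" for x
    using that by (auto simp: cube_def)
  then show ?thesis
    unfolding realizable_def using f g implements_tensor[OF f(2) g(2)]
    by (intro exI[of _ "c * d"] exI[of _ "\<lambda>y. F (take k y) * G (drop k y)"])
      (simp add: fourier_tensor)
qed

lemma realizable_fictitious:
  assumes "realizable k f"
  shows "realizable (Suc k) (\<lambda>x. f (butlast x))"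
proof -
  obtain c F where f: "c > 0" "implements P W k F" "\<And>x. x \<in> cube k \<Longrightarrow> fourier k f x = c * F x"
    using assms by (auto simp: realizable_def)
  have "take k x \<in> cube k" if "x \<in> cube (Suc k)" for x
    using that by (auto simp: cube_def)
  then show ?thesis
    unfolding realizable_def using f implements_tensor[OF f(2) implements_not]
    by (intro exI[of _ c] exI[of _ "\<lambda>y. F (take k y) * of_bool (\<not> drop k y ! 0)"])
      (simp add: fourier_fictitious)
qed

lemma realizable_permute:
  assumes "realizable k f" "\<pi> permutes {..<k}"
  shows "realizable k (\<lambda>x. f (permute_list \<pi> x))"
proof -
  obtain c F where f: "c > 0" "implements P W k F" "\<And>x. x \<in> cube k \<Longrightarrow> fourier k f x = c * F x"
    using assms by (auto simp: realizable_def)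
  have "permute_list \<pi> x \<in> cube k" if "x \<in> cube k" for x
    using that by (auto simp: cube_def)
  then show ?thesis
    unfolding realizable_def using f implements_permute[OF f(2) assms(2)]
    by (intro exI[of _ c] exI[of _ "\<lambda>y. F (permute_list \<pi> y)"])
      (simp add: fourier_permute[OF assms(2)])
qed

lemma realizable_sum_last:
  assumes "realizable (Suc k) f"
  shows "realizable k (\<lambda>x. \<Sum>b\<in>{False, True}. f (x @ [b]))"
proof -
  obtain c F where f: "c > 0" "implements P W (Suc k) F"
    "\<And>x. x \<in> cube (Suc k) \<Longrightarrow> fourier (Suc k) f x = c * F x"
    using assms by (auto simp: realizable_def)
  have "fourier k (\<lambda>x. \<Sum>b\<in>{False, True}. f (x @ [b])) x = 2 * c * F (x @ [False])"
    if "x \<in> cube k" for x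
    unfolding fourier_sum_last[OF that] using f(3) that by simp
  then show ?thesis
    unfolding realizable_def using implements_pin[OF f(2)] f(1)
    by (intro exI[of _ "2 * c"] exI[of _ "\<lambda>y. F (y @ [False])"]) (simp del: sum.insert)
qed

lemma realizable_diagonal:
  assumes "realizable (Suc k) f" "i < k"
  shows "realizable k (\<lambda>x. f (x @ [x ! i]))"
proof -
  obtain c F where f: "c > 0" "implements P W (Suc k) F"
    "\<And>x. x \<in> cube (Suc k) \<Longrightarrow> fourier (Suc k) f x = c * F x"
    using assms by (auto simp: realizable_def)
  obtain d where d: "d > 0"
    "implements P W k (\<lambda>y. d * (\<Sum>b\<in>{False, True}. F (y[i := (y ! i \<noteq> b)] @ [b])))"
    using implements_merge[OF f(2) assms(2)] .
  have "fourier k (\<lambda>x. f (x @ [x ! i])) x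
      = c / d * (d * (\<Sum>b\<in>{False, True}. F (x[i := (x ! i \<noteq> b)] @ [b])))" if x: "x \<in> cube k" for x
  proof -
    have "x[i := (x ! i \<noteq> b)] @ [b] \<in> cube (Suc k)" for b using x by (simp add: cube_def)
    then show ?thesis
      using d(1) unfolding fourier_diagonal[OF assms(2) x] by (simp only: f(3)) (simp add: distrib_left)
  qed
  then show ?thesis
    unfolding realizable_def using f(1) d
    by (intro exI[of _ "c / d"] exI conjI ballI) (auto intro: d(2))
qed

text \<open>
  The arguments of \<open>g\<close> are identified with those of \<open>f\<close> from the last to the first, so that the
  argument to be eliminated is always the last one.
\<close>

lemma realizable_product:
  assumes "realizable k f" "realizable k g"
  shows "realizable k (\<lambda>x. f x * g x)"
proof -
  \<comment> \<open>Invariant: the last \<open>j\<close> arguments of \<open>g\<close> are already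
    read from the last \<open>j\<close> arguments of \<open>f\<close>, and the first
    \<open>k - j\<close> are still its own.\<close>
  have "realizable (k + (k - j)) (\<lambda>z. f (take k z) * g (drop k z @ drop (k - j) (take k z)))"
    if "j \<le> k" for j
    using that
  proof (induction j)
    case 0
    then show ?case
      using realizable_tensor[OF assms] by (subst realizable_cong) (auto simp: cube_def)
  next
    case (Suc j)
    let ?l = "k + (k - Suc j)" and ?i = "k - Suc j"
    let ?h = "\<lambda>z. f (take k z) * g (drop k z @ drop (k - j) (take k z))"
    have "realizable (Suc ?l) ?h"
      using Suc by (simp add: Suc_diff_Suc)
    \<comment> \<open>The last of the \<open>Suc ?l\<close> arguments is argument \<open>?i\<close>
      of \<open>g\<close>; it is set equal to argument \<open>?i\<close> of
      \<open>f\<close>.\<close>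
    then have "realizable ?l (\<lambda>z. ?h (z @ [z ! ?i]))"
      by (rule realizable_diagonal) (use Suc.prems in simp)
    moreover have "?h (z @ [z ! ?i]) = f (take k z) * g (drop k z @ drop (k - Suc j) (take k z))"
      if "z \<in> cube ?l" for z
    proof -
      have "drop (k - Suc j) (take k z) = take k z ! ?i # drop (Suc ?i) (take k z)"
        using that Suc.prems by (subst Cons_nth_drop_Suc) (auto simp: cube_def)
      then show ?thesis
        using that Suc.prems by (simp add: cube_def Suc_diff_Suc)
    qed
    ultimately show ?case by (subst (asm) realizable_cong) auto
  qed
  from this[of k] have "realizable k (\<lambda>z. f (take k z) * g (drop k z @ take k z))"
    by simp
  moreover have "realizable k (\<lambda>z. f (take k z) * g (drop k z @ take k z))
      \<longleftrightarrow> realizable k (\<lambda>x. f x * g x)"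
    by (rule realizable_cong) (simp add: cube_def)
  ultimately show ?thesis by simp
qed

section \<open>Clone closure for both classes at once\<close>

text \<open>The match class is the case \<open>S = {1}\<close>, the even class is the case \<open>S = {0..}\<close>.\<close>

definition scaled_class :: "real set \<Rightarrow> (nat \<times> bfun) set" where
  "scaled_class S = {(k, \<lambda>x\<in>cube k. c * f x) | k c f. c \<in> S \<and> f \<in> nonneg_funs k \<and> realizable k f}"

lemma scaled_classI:
  assumes "c \<in> S" "realizable k g" "\<And>x. x \<in> cube k \<Longrightarrow> g x \<ge> 0"
    "\<And>x. x \<in> cube k \<Longrightarrow> f x = c * g x"
  shows "(k, restrict f (cube k)) \<in> scaled_class S"
proof -
  have "(\<lambda>x\<in>cube k. g x) \<in> nonneg_funs k" using assms(3) by (auto simp: nonneg_funs_def)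
  moreover have "realizable k (\<lambda>x\<in>cube k. g x)" using assms(2) by (subst realizable_cong) auto
  moreover have "restrict f (cube k) = (\<lambda>x\<in>cube k. c * (\<lambda>x\<in>cube k. g x) x)"
    using assms(4) by (intro restrict_ext) simp
  ultimately show ?thesis unfolding scaled_class_def using assms(1) by blast
qed

lemma scaled_classE:
  assumes "(k, f) \<in> scaled_class S"
  obtains c g where "c \<in> S" "realizable k g" "\<And>x. x \<in> cube k \<Longrightarrow> g x \<ge> 0"
    "\<And>x. x \<in> cube k \<Longrightarrow> f x = c * g x"
proof -
  obtain c g where "c \<in> S" "g \<in> nonneg_funs k" "realizable k g" "f = (\<lambda>x\<in>cube k. c * g x)"
    using assms by (auto simp: scaled_class_def)
  then show thesis by (intro that[of c g]) (auto simp: nonneg_funs_def PiE_def Pi_def)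
qed

text \<open>The coefficient is 1 for \<open>EQ\<close>, gets multiplied in products and is otherwise
  unchanged, which explains the conditions on \<open>S\<close>. Every operation keeps the underlying
  function nonnegative.\<close>

theorem clone_closure_scaled_class:
  assumes "1 \<in> S" "\<And>a b. a \<in> S \<Longrightarrow> b \<in> S \<Longrightarrow> a * b \<in> S"
  shows "clone_closure (scaled_class S) = scaled_class S"
proof (intro equalityI subrelI)
  fix k f assume "(k, f) \<in> clone_closure (scaled_class S)"
  then show "(k, f) \<in> scaled_class S"
  proof induction
    case eq
    have "(2, restrict EQ (cube 2)) \<in> scaled_class S"
      using assms(1) by (rule scaled_classI[OF _ realizable_EQ]) (simp_all add: EQ_def)
    moreover have "restrict EQ (cube 2) = EQ"
      unfolding EQ_def by (simp only: restrict_restrict Int_absorb)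
    ultimately show ?case by (simp only:)
  next
    case (fictitious k f)
    then obtain c g where g: "c \<in> S" "realizable k g" "\<And>x. x \<in> cube k \<Longrightarrow> g x \<ge> 0"
      "\<And>x. x \<in> cube k \<Longrightarrow> f x = c * g x" by (auto elim: scaled_classE)
    have "butlast x \<in> cube k" if "x \<in> cube (Suc k)" for x using that by (auto simp: cube_def)
    then show ?case
      using g by (intro scaled_classI[OF g(1) realizable_fictitious[OF g(2)]]) auto
  next
    case (permute k f \<pi>)
    then obtain c g where g: "c \<in> S" "realizable k g" "\<And>x. x \<in> cube k \<Longrightarrow> g x \<ge> 0"
      "\<And>x. x \<in> cube k \<Longrightarrow> f x = c * g x" by (auto elim: scaled_classE)
    have "permute_list \<pi> x \<in> cube k" if "x \<in> cube k" for x using that by (auto simp: cube_def)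
    then show ?case
      using g by (intro scaled_classI[OF g(1) realizable_permute[OF g(2) permute.hyps(2)]]) auto
  next
    case (product k f f')
    obtain c g where g: "c \<in> S" "realizable k g" "\<And>x. x \<in> cube k \<Longrightarrow> g x \<ge> 0"
      "\<And>x. x \<in> cube k \<Longrightarrow> f x = c * g x" using product.IH(1) by (auto elim: scaled_classE)
    obtain c' g' where g': "c' \<in> S" "realizable k g'" "\<And>x. x \<in> cube k \<Longrightarrow> g' x \<ge> 0"
      "\<And>x. x \<in> cube k \<Longrightarrow> f' x = c' * g' x" using product.IH(2) by (auto elim: scaled_classE)
    show ?case
      using g g' assms(2)
      by (intro scaled_classI[OF _ realizable_product[OF g(2) g'(2)], of "c * c'"]) auto
  next
    case (summation k f)
    then obtain c g where g: "c \<in> S" "realizable (Suc k) g" "\<And>x. x \<in> cube (Suc k) \<Longrightarrow> g x \<ge> 0"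
      "\<And>x. x \<in> cube (Suc k) \<Longrightarrow> f x = c * g x" by (auto elim: scaled_classE)
    then show ?case
      by (intro scaled_classI[OF g(1) realizable_sum_last[OF g(2)]]) (auto simp: distrib_left)
  qed
qed (auto intro: clone_closure.base)

end

section \<open>The two classes as instances\<close>

interpretation matching: matching_or_even "\<lambda>d. d = 1" "{0<..}"
  by unfold_locales auto

interpretation even_subgraph: matching_or_even even "{0<..1}"
  by unfold_locales auto

lemma match_class_iff:
  "(k, f) \<in> match_class \<longleftrightarrow> f \<in> nonneg_funs k \<and> implements (\<lambda>d. d = 1) {0<..} k (fourier k f)"
  unfolding match_class_def match_circuit_def match_fun_def match_sets_def
  using implements_iff_circuit[OF matching.one_in_W, where P = "\<lambda>d. d = 1"] by simp

lemma even_class_eq: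
  "even_class = {(k, \<lambda>x\<in>cube k. c * f x) | k c f.
    c \<ge> 0 \<and> f \<in> nonneg_funs k \<and> implements even {0<..1} k (fourier k f)}"
  unfolding even_class_def even_circuit_def even_fun_def even_sets_def
  using implements_iff_circuit[OF even_subgraph.one_in_W, where P = even] by simp

text \<open>Any \<open>c > 0\<close> is an admissible weight in a match-circuit, so the constant of
  \<open>realizable\<close> enters the circuit as an isolated edge.\<close>

lemma match_class_eq: "match_class = matching.scaled_class {1}"
proof (intro equalityI subrelI)
  fix k f assume "(k, f) \<in> match_class"
  then have f: "f \<in> nonneg_funs k" "implements (\<lambda>d. d = 1) {0<..} k (fourier k f)"
    by (auto simp: match_class_iff)
  have "matching.realizable k f"
    unfolding matching.realizable_def using f(2) by (intro exI[of _ 1] exI[of _ "fourier k f"]) simp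
  then have "(k, restrict f (cube k)) \<in> matching.scaled_class {1}"
    using f(1) by (intro matching.scaled_classI[where g = f]) (auto simp: nonneg_funs_def PiE_def Pi_def)
  then show "(k, f) \<in> matching.scaled_class {1}"
    using f(1) by (simp only: nonneg_funs_def PiE_restrict)
next
  fix k f assume "(k, f) \<in> matching.scaled_class {1}"
  then obtain g where g: "g \<in> nonneg_funs k" "matching.realizable k g" "f = (\<lambda>x\<in>cube k. 1 * g x)"
    unfolding matching.scaled_class_def by blast
  then have "f = g" by (auto simp: nonneg_funs_def PiE_def extensional_def)
  obtain c F where F: "c > 0" "implements (\<lambda>d. d = 1) {0<..} k F" "\<And>x. x \<in> cube k \<Longrightarrow> fourier k g x = c * F x"
    using g(2) unfolding matching.realizable_def by blast
  \<comment> \<open>The isolated edge is a circuit of arity 0, hence a tensor factor without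
    arguments.\<close>
  have "implements (\<lambda>d. d = 1) {0<..} (k + 0) (\<lambda>y. F (take k y) * c)"
    using F(1,2) by (intro implements_tensor implements_const) auto
  then have "implements (\<lambda>d. d = 1) {0<..} k (\<lambda>y. F (take k y) * c)"
    by (simp only: add_0_right)
  then have "implements (\<lambda>d. d = 1) {0<..} k (fourier k g)"
    by (rule implements_cong) (simp add: F(3), simp add: cube_def)
  then show "(k, f) \<in> match_class" using g(1) \<open>f = g\<close> by (simp add: match_class_iff)
qed

lemma even_class_eq_scaled: "even_class = even_subgraph.scaled_class {0..}"
proof (intro equalityI subrelI)
  fix k f assume "(k, f) \<in> even_class"
  then obtain c g where g: "c \<ge> 0" "g \<in> nonneg_funs k" "implements even {0<..1} k (fourier k g)"
    "f = (\<lambda>x\<in>cube k. c * g x)"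
    by (auto simp: even_class_eq)
  have "even_subgraph.realizable k g"
    unfolding even_subgraph.realizable_def using g(3)
    by (intro exI[of _ 1] exI[of _ "fourier k g"]) simp
  then show "(k, f) \<in> even_subgraph.scaled_class {0..}"
    unfolding even_subgraph.scaled_class_def using g by auto
next
  fix k f assume "(k, f) \<in> even_subgraph.scaled_class {0..}"
  then obtain c g where g: "c \<ge> 0" "g \<in> nonneg_funs k" "even_subgraph.realizable k g"
    "f = (\<lambda>x\<in>cube k. c * g x)"
    by (auto simp: even_subgraph.scaled_class_def)
  obtain d F where F: "d > 0" "implements even {0<..1} k F" "\<And>x. x \<in> cube k \<Longrightarrow> fourier k g x = d * F x"
    using g(3) by (auto simp: even_subgraph.realizable_def)
  \<comment> \<open>Dividing by \<open>d\<close> makes the transform equal to \<open>F\<close>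
    itself; \<open>d\<close> moves into the coefficient, which becomes \<open>c * d\<close> and may
    still be 0.\<close>
  define h where "h = (\<lambda>x\<in>cube k. g x / d)"
  have "fourier k h = fourier k (\<lambda>x. 1 / d * g x)"
    by (rule fourier_cong) (simp add: h_def)
  then have "implements even {0<..1} k (fourier k h)"
    using F by (intro implements_cong[OF F(2)]) (simp only: fourier_scale, simp)
  moreover have "h \<in> nonneg_funs k"
    using g(2) F(1) by (auto simp: h_def nonneg_funs_def PiE_def Pi_def)
  moreover have "f = (\<lambda>x\<in>cube k. (c * d) * h x)"
    using F(1) unfolding g(4) h_def by (intro restrict_ext) simp
  moreover have "c * d \<ge> 0" using g(1) F(1) by simp
  ultimately show "(k, f) \<in> even_class" unfolding even_class_eq by blast
qed

theorem theorem3p3: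
  shows "clone_closure even_class = even_class \<and> clone_closure match_class = match_class"
  unfolding even_class_eq_scaled match_class_eq
  by (intro conjI even_subgraph.clone_closure_scaled_class matching.clone_closure_scaled_class) auto

end
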